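(* Let $(D,Q)$ be a discriminant form and assume that $D$ possesses at least one self-dual isotropic subgroup. Then the space $\mathbb{C}[D]^{\mathrm{Mp}_2(\mathbb{Z})}=\{v\in\mathbb{C}[D] : \varrho_D(g)v=v \text{ for all } g\in \mathrm{Mp}_2(\mathbb{Z})\}$ of invariants of the Weil representation (which here factors through $\mathrm{SL}_2(\mathbb{Z})$) is spanned by the characteristic functions $v^H=\sum_{\gamma\in H}\mathfrak{e}_\gamma$ of the self-dual isotropic subgroups $H$ of $D$.
   Context: A discriminant form is a finite abelian group $D$ with a non-degenerate quadratic form $Q\colon D\to\mathbb{Q}/\mathbb{Z}$, with associated bilinear form $(\beta,\gamma)=Q(\beta+\gamma)-Q(\beta)-Q(\gamma)$. Its signature $\mathrm{sign}(D)\in\mathbb{Z}/8\mathbb{Z}$ is defined by $\mathbf{e}(\mathrm{sign}(D)/8)=|D|^{-1/2}\sum_{\gamma\in D}\mathbf{e}(Q(\gamma))$, where $\mathbf{e}(z)=\exp(2\pi i z)$. $\mathrm{Mp}_2(\mathbb{Z})$ is the metaplectic double cover of $\mathrm{SL}_2(\mathbb{Z})$ (pairs $(M,\phi)$ with $\phi$ a holomorphic square root of $c\tau+d$), generated by $T=((\begin{smallmatrix}1&1\\0&1\end{smallmatrix}),1)$ and $S=((\begin{smallmatrix}0&-1\\1&0\end{smallmatrix}),\sqrt{\tau})$. The Weil representation $\varrho_D$ on the group ring $\mathbb{C}[D]$ with standard basis $(\mathfrak{e}_\gamma)_{\gamma\in D}$ is given by $\varrho_D(T)\mathfrak{e}_\gamma=\mathbf{e}(Q(\gamma))\mathfrak{e}_\gamma$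 and $\varrho_D(S)\mathfrak{e}_\gamma=\frac{\mathbf{e}(\mathrm{sign}(D)/8)}{\sqrt{|D|}}\sum_{\beta\in D}\mathbf{e}(-(\beta,\gamma))\mathfrak{e}_\beta$. For a subgroup $H\subseteq D$, $H^\perp=\{\gamma\in D:(\gamma,\beta)=0\ \forall \beta\in H\}$; $H$ is self-dual if $H=H^\perp$, and isotropic if $H\subseteq H^\perp$ and $Q$ vanishes on $H$. *)

theory Defs
  imports "HOL-Analysis.Analysis" "HOL-Algebra.Group"
begin

section \<open>The group of rationals modulo integers\<close>

quotient_type rat_mod_int = rat / "\<lambda>x y :: rat. x - y \<in> \<int>"
proof (rule equivpI)
  show "reflp (\<lambda>x y :: rat. x - y \<in> \<int>)"
    by (simp add: reflp_def)
  show "symp (\<lambda>x y :: rat. x - y \<in> \<int>)"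
    unfolding symp_def using Ints_minus by fastforce
  show "transp (\<lambda>x y :: rat. x - y \<in> \<int>)"
    unfolding transp_def using Ints_add by fastforce
qed

instantiation rat_mod_int :: ab_group_add
begin

lift_definition zero_rat_mod_int :: rat_mod_int is "0" .

lift_definition plus_rat_mod_int :: "rat_mod_int \<Rightarrow> rat_mod_int \<Rightarrow> rat_mod_int" is "(+)"
  using Ints_add by (fastforce simp: algebra_simps)

lift_definition uminus_rat_mod_int :: "rat_mod_int \<Rightarrow> rat_mod_int" is "uminus"
  using Ints_minus by fastforce

lift_definition minus_rat_mod_int :: "rat_mod_int \<Rightarrow> rat_mod_int \<Rightarrow> rat_mod_int" is "(-)"
  using Ints_diff by (fastforce simp: algebra_simps)

instance
  by standard (transfer; simp)+

end

definition e2pi :: "complex \<Rightarrow> complex" where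
  "e2pi z = exp (2 * complex_of_real pi * \<i> * z)"

lemma e2pi_cong:
  assumes "x - y \<in> \<int>"
  shows "e2pi (of_rat x) = e2pi (of_rat y)"
proof -
  obtain n :: int where "x - y = of_int n"
    using assms by (auto elim: Ints_cases)
  then have "x = y + of_int n" by simp
  then have "of_rat x = of_rat y + (of_int n :: complex)"
    by (simp add: of_rat_add)
  then show ?thesis
    unfolding e2pi_def by (simp add: exp_eq algebra_simps)
qed

lift_definition e_mod :: "rat_mod_int \<Rightarrow> complex" is "\<lambda>x. e2pi (of_rat x)"
  by (rule e2pi_cong)

section \<open>Discriminant forms\<close>

text \<open>A finite abelian group is a type of class finite and \<open>ab_group_add\<close>. The monoid record below
  gives access to the library's subgroups; its powers \<open>[^]\<close> are the integer multiples.\<close>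

definition add_grp :: "'a::ab_group_add monoid" where
  "add_grp = \<lparr>carrier = UNIV, mult = (+), one = 0\<rparr>"

definition bilin :: "('d::ab_group_add \<Rightarrow> rat_mod_int) \<Rightarrow> 'd \<Rightarrow> 'd \<Rightarrow> rat_mod_int" where
  "bilin Q \<beta> \<gamma> = Q (\<beta> + \<gamma>) - Q \<beta> - Q \<gamma>"

definition quadratic_form :: "('d::ab_group_add \<Rightarrow> rat_mod_int) \<Rightarrow> bool" where
  "quadratic_form Q \<longleftrightarrow>
    (\<forall>(n::int) \<gamma>. Q (\<gamma> [^]\<^bsub>add_grp\<^esub> n) = Q \<gamma> [^]\<^bsub>add_grp\<^esub> (n ^ 2)) \<and>
    (\<forall>\<alpha> \<beta> \<gamma>. bilin Q (\<alpha> + \<beta>) \<gamma> = bilin Q \<alpha> \<gamma> + bilin Q \<beta> \<gamma>) \<and>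
    (\<forall>\<alpha> \<beta> \<gamma>. bilin Q \<alpha> (\<beta> + \<gamma>) = bilin Q \<alpha> \<beta> + bilin Q \<alpha> \<gamma>)"

definition discriminant_form :: "('d::{finite,ab_group_add} \<Rightarrow> rat_mod_int) \<Rightarrow> bool" where
  "discriminant_form Q \<longleftrightarrow>
    quadratic_form Q \<and> (\<forall>\<gamma>. (\<forall>\<beta>. bilin Q \<gamma> \<beta> = 0) \<longrightarrow> \<gamma> = 0)"

definition perp :: "('d::ab_group_add \<Rightarrow> rat_mod_int) \<Rightarrow> 'd set \<Rightarrow> 'd set" where
  "perp Q H = {\<gamma>. \<forall>\<beta>\<in>H. bilin Q \<gamma> \<beta> = 0}"

definition self_dual :: "('d::ab_group_add \<Rightarrow> rat_mod_int) \<Rightarrow> 'd set \<Rightarrow> bool" where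
  "self_dual Q H \<longleftrightarrow> H = perp Q H"

definition isotropic :: "('d::ab_group_add \<Rightarrow> rat_mod_int) \<Rightarrow> 'd set \<Rightarrow> bool" where
  "isotropic Q H \<longleftrightarrow> H \<subseteq> perp Q H \<and> (\<forall>\<gamma>\<in>H. Q \<gamma> = 0)"

definition self_dual_isotropic_subgroups ::
  "('d::{finite,ab_group_add} \<Rightarrow> rat_mod_int) \<Rightarrow> 'd set set" where
  "self_dual_isotropic_subgroups Q = {H. subgroup H add_grp \<and> self_dual Q H \<and> isotropic Q H}"

text \<open>The signature, an element of the integers modulo 8, is represented by its residue in
  \<open>{0..<8}\<close>.\<close>

definition signature :: "('d::{finite,ab_group_add} \<Rightarrow> rat_mod_int) \<Rightarrow> int" where
  "signature Q = (THE s. s \<in> {0..<8} \<and>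
    e2pi (of_int s / 8) =
      (\<Sum>\<gamma>\<in>UNIV. e_mod (Q \<gamma>)) / complex_of_real (sqrt (real CARD('d))))"

section \<open>The metaplectic group\<close>

definition upper_half_plane :: "complex set" where
  "upper_half_plane = {\<tau>. Im \<tau> > 0}"

definition moebius_map :: "int^2^2 \<Rightarrow> complex \<Rightarrow> complex" where
  "moebius_map M \<tau> = (of_int (M$1$1) * \<tau> + of_int (M$1$2)) / (of_int (M$2$1) * \<tau> + of_int (M$2$2))"

definition SL2Z :: "(int^2^2) monoid" where
  "SL2Z = \<lparr>carrier = {M. det M = 1}, mult = (**), one = mat 1\<rparr>"

type_synonym mp2_elem = "(int^2^2) \<times> (complex \<Rightarrow> complex)"

text \<open>The square root in the second component is a function on the upper half plane; it is made
  \<open>extensional\<close> so that equality of pairs is the intended one.\<close>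

definition Mp2Z :: "mp2_elem monoid" where
  "Mp2Z =
    \<lparr>carrier = {(M, \<phi>). M \<in> carrier SL2Z \<and> \<phi> \<in> extensional upper_half_plane \<and>
        \<phi> holomorphic_on upper_half_plane \<and>
        (\<forall>\<tau>\<in>upper_half_plane. (\<phi> \<tau>)^2 = of_int (M$2$1) * \<tau> + of_int (M$2$2))},
     mult = (\<lambda>(M, \<phi>) (M', \<phi>').
        (M ** M', \<lambda>\<tau>\<in>upper_half_plane. \<phi> (moebius_map M' \<tau>) * \<phi>' \<tau>)),
     one = (mat 1, \<lambda>\<tau>\<in>upper_half_plane. 1)\<rparr>"

definition Mp2Z_T :: mp2_elem where
  "Mp2Z_T = (vector [vector [1, 1], vector [0, 1]], \<lambda>\<tau>\<in>upper_half_plane. 1)"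

definition Mp2Z_S :: mp2_elem where
  "Mp2Z_S = (vector [vector [0, -1], vector [1, 0]], \<lambda>\<tau>\<in>upper_half_plane. csqrt \<tau>)"

section \<open>The Weil representation\<close>

text \<open>The group ring (as a vector space) is \<open>complex^'d\<close>, with standard basis \<open>axis \<gamma> 1\<close>.\<close>

definition GL :: "(complex^'d \<Rightarrow> complex^'d) monoid" where
  "GL = \<lparr>carrier = {f. Vector_Spaces.linear (*s) (*s) f \<and> bij f}, mult = (\<circ>), one = id\<rparr>"

text \<open>T and S generate \<open>Mp2Z\<close>, so at most one homomorphism (restricted to the carrier) satisfies
  the following. With the sign in the exponent of the formula for S as chosen here, the
  formulas are compatible with the relation \<open>(S T)\<^sup>3 = S\<^sup>2\<close> if and only if 4 divides the
  signature. In the presence of a self-dual isotropic subgroup the signature is 0.\<close>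

definition weil_representation ::
  "('d::{finite,ab_group_add} \<Rightarrow> rat_mod_int) \<Rightarrow>
   (mp2_elem \<Rightarrow> (complex, 'd) vec \<Rightarrow> (complex, 'd) vec) \<Rightarrow> bool" where
  "weil_representation Q \<rho> \<longleftrightarrow>
    \<rho> \<in> hom Mp2Z GL \<and>
    (\<forall>\<gamma>. \<rho> Mp2Z_T (axis \<gamma> 1) = e_mod (Q \<gamma>) *s axis \<gamma> 1) \<and>
    (\<forall>\<gamma>. \<rho> Mp2Z_S (axis \<gamma> 1) =
      (e2pi (of_int (signature Q) / 8) / complex_of_real (sqrt (real CARD('d)))) *s
      (\<Sum>\<beta>\<in>UNIV. e_mod (- bilin Q \<beta> \<gamma>) *s axis \<beta> 1))"

definition invariants ::
  "(mp2_elem \<Rightarrow> complex^'d \<Rightarrow> complex^'d) \<Rightarrow> (complex^'d) set" where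
  "invariants \<rho> = {v. \<forall>g\<in>carrier Mp2Z. \<rho> g v = v}"

definition char_vec :: "'d set \<Rightarrow> complex^'d::finite" where
  "char_vec H = (\<Sum>\<gamma>\<in>H. axis \<gamma> 1)"

end

(*
  Let H be a self-dual isotropic subgroup. The vectors obtained from v^H by translating by x and
  multiplying by the character of y span C[D]. For fixed x and y they extend to a family phi(m)
  indexed by integral 2x2 matrices m, periodic modulo a suitable N, on which S and T act by right
  multiplication, S.phi(m) = phi(mS) and T.phi(m) = phi(mT). As S and T generate SL2(Z/N), every
  invariant is a combination of the sums of phi(m) over all m modulo N with det m = 1. By Fourier
  inversion in the determinant such a sum is a combination of the sums of chi(det m) phi(m) over all
  m modulo N, where chi runs through the characters of Z/N. Evaluating the sum over the second
  column of m shows that each of these is a nonzero multiple of v^G with G a subgroup on which Q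
  vanishes, and G is self-dual because the sum is fixed by S.

  The representation factors through SL2(Z) since the signature is 0, so that S^4, which is the
  nontrivial element over the identity matrix, acts trivially.
*)

theory Submission
  imports Defs "HOL-Number_Theory.Cong" "HOL-Algebra.Multiplicative_Group"
begin

section \<open>Integer multiples and character sums\<close>

text \<open>Writing the powers in \<open>add_grp\<close> as a scalar action turns both D and Q/Z
  into modules over the integers, so one calculus serves for both.\<close>

definition zmul :: "int \<Rightarrow> 'a::ab_group_add \<Rightarrow> 'a"  (infixr "\<cdot>" 75)
  where "n \<cdot> x = x [^]\<^bsub>add_grp\<^esub> n"

lemma comm_group_add_grp: "comm_group (add_grp :: 'a::ab_group_add monoid)"
proof (rule comm_groupI)
  fix x :: 'a
  show "\<exists>y\<in>carrier add_grp. y \<otimes>\<^bsub>add_grp\<^esub> x = \<one>\<^bsub>add_grp\<^esub>"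
    by (intro bexI[of _ "- x"]) (auto simp: add_grp_def)
qed (auto simp: add_grp_def add_ac)

lemma add_grp_simps [simp]:
  "carrier add_grp = UNIV" "x \<otimes>\<^bsub>add_grp\<^esub> y = x + y" "\<one>\<^bsub>add_grp\<^esub> = 0"
  by (auto simp: add_grp_def)

interpretation add_grp: comm_group "add_grp :: 'a::ab_group_add monoid"
  by (rule comm_group_add_grp)

lemma m_inv_add_grp [simp]: "inv\<^bsub>add_grp\<^esub> x = - x"
  by (rule add_grp.inv_equality) auto

interpretation zmul: Modules.module "zmul :: int \<Rightarrow> 'a \<Rightarrow> 'a::ab_group_add"
proof
  fix a b :: int and x y :: 'a
  show "a \<cdot> (x + y) = a \<cdot> x + a \<cdot> y"
    using add_grp.int_pow_distrib[of x y a] by (simp add: zmul_def)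
  show "(a + b) \<cdot> x = a \<cdot> x + b \<cdot> x"
    using add_grp.int_pow_mult[of x a b] by (simp add: zmul_def)
  show "a \<cdot> b \<cdot> x = (a * b) \<cdot> x"
    using add_grp.int_pow_pow[of x b a] by (simp add: zmul_def mult.commute)
  show "1 \<cdot> x = x"
    by (simp add: zmul_def)
qed

lemma additive_zmul:
  fixes f :: "'a::ab_group_add \<Rightarrow> 'b::ab_group_add"
  assumes "\<And>x y. f (x + y) = f x + f y"
  shows "f (n \<cdot> x) = n \<cdot> f x"
proof -
  have 0: "f 0 = 0" using assms[of 0 0] by simp
  have m: "f (- x) = - f x" for x using assms[of x "- x"] 0 by (simp add: eq_neg_iff_add_eq_0 add.commute)
  show ?thesis
  proof (induction n rule: int_induct[where k = 0])
    case (step1 i) then show ?case by (simp add: zmul.scale_left_distrib assms)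
  next
    case (step2 i)
    have "f ((i - 1) \<cdot> x) = f (i \<cdot> x + - x)" by (simp add: zmul.scale_left_diff_distrib)
    also have "\<dots> = (i - 1) \<cdot> f x" unfolding assms m step2 by (simp add: zmul.scale_left_diff_distrib)
    finally show ?case .
  qed (simp add: 0)
qed

lemma card_zmul: "int CARD('d) \<cdot> (x :: 'd::{finite,ab_group_add}) = 0"
  using add_grp.pow_order_eq_1[of x] by (simp add: zmul_def order_def int_pow_int)

lemma zmul_abs_rat_mod_int: "n \<cdot> abs_rat_mod_int q = abs_rat_mod_int (of_int n * q)"
proof (induction n rule: int_induct[where k = 0])
  case base then show ?case by (simp add: zero_rat_mod_int.abs_eq)
next
  case (step1 i) then show ?case
    by (simp add: zmul.scale_left_distrib plus_rat_mod_int.abs_eq algebra_simps)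
next
  case (step2 i) then show ?case
    by (simp add: zmul.scale_left_diff_distrib minus_rat_mod_int.abs_eq algebra_simps)
qed

section \<open>The character of Q/Z and orthogonality relations\<close>

lemma e_mod_0 [simp]: "e_mod 0 = 1"
  by transfer (simp add: e2pi_def)

lemma e_mod_add: "e_mod (a + b) = e_mod a * e_mod b"
  by transfer (simp add: e2pi_def of_rat_add distrib_left exp_add)

lemma e_mod_nonzero [simp]: "e_mod a \<noteq> 0"
  by transfer (simp add: e2pi_def)

lemma e_mod_minus: "e_mod (- a) = inverse (e_mod a)"
  using e_mod_add[of a "- a"] by (simp add: inverse_unique)

lemma e2pi_of_rat_eq_1_iff: "e2pi (of_rat q) = 1 \<longleftrightarrow> q \<in> \<int>"
proof
  assume "e2pi (of_rat q) = 1"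
  then obtain n :: int where n: "Im (2 * complex_of_real pi * \<i> * of_rat q) = of_int (2 * n) * pi"
    unfolding e2pi_def exp_eq_1 by blast
  have c: "(of_rat q :: complex) = of_real (of_rat q)" by (cases q) (simp add: of_rat_rat)
  have "2 * pi * real_of_rat q = of_int (2 * n) * pi" using n unfolding c by simp
  then have "real_of_rat q = real_of_rat (of_int n)" by simp
  then have "q = of_int n" unfolding of_rat_eq_iff .
  then show "q \<in> \<int>" by simp
next
  assume "q \<in> \<int>"
  then show "e2pi (of_rat q) = 1" using e2pi_cong[of q 0] by (simp add: e2pi_def)
qed

lemma e_mod_eq_1_iff [simp]: "e_mod a = 1 \<longleftrightarrow> a = 0"
  by transfer (simp add: e2pi_of_rat_eq_1_iff)

text \<open>Orthogonality of characters: translating by an element \<open>k\<close> of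
  \<open>H\<close> with \<open>f k \<noteq> 0\<close> preserves the sum but multiplies it by
  \<open>e_mod (f k) \<noteq> 1\<close>, so the sum vanishes.\<close>

lemma sum_e_mod_subgroup:
  fixes f :: "'a::ab_group_add \<Rightarrow> rat_mod_int"
  assumes H: "subgroup H add_grp" "finite H" and add: "\<And>x y. f (x + y) = f x + f y"
  shows "(\<Sum>h\<in>H. e_mod (f h)) = (if \<forall>h\<in>H. f h = 0 then of_nat (card H) else 0)"
proof (cases "\<forall>h\<in>H. f h = 0")
  case False
  then obtain k where k: "k \<in> H" "f k \<noteq> 0" by auto
  have cl: "x + y \<in> H" "- x + y \<in> H" if "x \<in> H" "y \<in> H" for x y
    using subgroup.m_closed[OF H(1), of x y] subgroup.m_inv_closed[OF H(1), of x]
      subgroup.m_closed[OF H(1), of "- x" y] that by auto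
  have "(\<Sum>h\<in>H. e_mod (f h)) = (\<Sum>h\<in>H. e_mod (f (k + h)))"
    by (rule sum.reindex_bij_witness[of _ "\<lambda>h. k + h" "\<lambda>h. - k + h"]) (use cl k in auto)
  also have "\<dots> = e_mod (f k) * (\<Sum>h\<in>H. e_mod (f h))"
    by (simp add: add e_mod_add sum_distrib_left)
  finally have "(1 - e_mod (f k)) * (\<Sum>h\<in>H. e_mod (f h)) = 0" by (simp add: algebra_simps)
  then show ?thesis using False k by (auto)
qed simp

text \<open>Matrix entries modulo \<open>N\<close> are represented by integers in
  \<open>{0..<N}\<close>. Adding \<open>k\<close> and reducing permutes these
  representatives.\<close>

lemma sum_periodic_shift:
  fixes f :: "int \<Rightarrow> 'a::comm_monoid_add"
  assumes "N > 0" and per: "\<And>p q. [p = q] (mod N) \<Longrightarrow> f p = f q"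
  shows "(\<Sum>p\<in>{0..<N}. f (p + k)) = (\<Sum>p\<in>{0..<N}. f p)"
proof (rule sum.reindex_bij_witness[of _ "\<lambda>p. (p - k) mod N" "\<lambda>p. (p + k) mod N"])
  fix p assume "p \<in> {0..<N}"
  show "f ((p + k) mod N) = f (p + k)" by (rule per) (simp add: cong_def)
qed (use assms in \<open>auto simp: mod_diff_left_eq mod_add_left_eq\<close>)

lemma sum_periodic_minus:
  fixes f :: "int \<Rightarrow> 'a::comm_monoid_add"
  assumes "N > 0" and per: "\<And>p q. [p = q] (mod N) \<Longrightarrow> f p = f q"
  shows "(\<Sum>p\<in>{0..<N}. f (- p)) = (\<Sum>p\<in>{0..<N}. f p)"
proof (rule sum.reindex_bij_witness[of _ "\<lambda>p. (- p) mod N" "\<lambda>p. (- p) mod N"])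
  fix p assume "p \<in> {0..<N}"
  show "f ((- p) mod N) = f (- p)" by (rule per) (simp add: cong_def)
qed (use assms in \<open>auto simp: mod_minus_eq\<close>)

lemma zmul_cong:
  assumes "[p = q] (mod N)" "N \<cdot> a = 0"
  shows "p \<cdot> a = q \<cdot> a"
proof -
  obtain k where "q = p + N * k" using assms(1) unfolding cong_iff_lin ..
  moreover have "(N * k) \<cdot> a = 0"
    using assms(2) zmul.scale_scale[of k N a] by (simp add: mult.commute)
  ultimately show ?thesis by (simp add: zmul.scale_left_distrib)
qed

text \<open>Orthogonality on the residues modulo \<open>N\<close>: shifting \<open>q\<close> by 1
  multiplies the sum by \<open>e_mod a\<close>.\<close>

lemma sum_e_mod_zmul:
  assumes N: "N > 0" and "N \<cdot> a = 0"
  shows "(\<Sum>q\<in>{0..<N}. e_mod (q \<cdot> a)) = (if a = 0 then of_int N else 0)"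
proof (cases "a = 0")
  case False
  have per: "e_mod (p \<cdot> a) = e_mod (q \<cdot> a)" if "[p = q] (mod N)" for p q
    using zmul_cong[OF that assms(2)] by simp
  have "(\<Sum>q\<in>{0..<N}. e_mod (q \<cdot> a)) = (\<Sum>q\<in>{0..<N}. e_mod ((q + 1) \<cdot> a))"
    using sum_periodic_shift[of N "\<lambda>q. e_mod (q \<cdot> a)" 1] N per by simp
  also have "\<dots> = e_mod a * (\<Sum>q\<in>{0..<N}. e_mod (q \<cdot> a))"
    by (simp add: zmul.scale_left_distrib e_mod_add sum_distrib_left mult.commute)
  finally have "(1 - e_mod a) * (\<Sum>q\<in>{0..<N}. e_mod (q \<cdot> a)) = 0" by (simp add: algebra_simps)
  then show ?thesis using False by auto
qed (use N in simp)

section \<open>Generation of the special linear group\<close>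

text \<open>For \<open>N = 0\<close> this is generation of the integral special linear group by S and T. Otherwise the row
  \<open>(g, 0)\<close> reached by the Euclidean algorithm has \<open>g\<close> a unit modulo \<open>N\<close> with inverse \<open>t\<close>, and
  the row is moved to \<open>(1, 0)\<close> through \<open>(g, 1)\<close> and \<open>(1, 1)\<close>.\<close>

lemma SL2_column_induct:
  fixes P :: "int \<Rightarrow> int \<Rightarrow> int \<Rightarrow> int \<Rightarrow> bool" and N :: int
  assumes one: "P 1 0 0 1"
    and T: "\<And>p q r t. P p (q + p) r (t + r) \<longleftrightarrow> P p q r t"
    and S': "\<And>p q r t. P p q r t \<Longrightarrow> P q (- p) t (- r)"
    and cong: "\<And>p q r t q' t'. [q = q'] (mod N) \<Longrightarrow> [t = t'] (mod N) \<Longrightarrow> P p q r t \<Longrightarrow> P p q' r t'"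
    and det: "[p * t - q * r = 1] (mod N)"
  shows "P p q r t"
proof -
  \<comment> \<open>The operation has order four on the entries, so three further applications
    invert it.\<close>
  have S: "P q (- p) t (- r) \<longleftrightarrow> P p q r t" for p q r t
    using S'[of p q r t] S'[of q "-p" t "-r"] S'[of "-p" "-q" "-r" "-t"] S'[of "-q" p "-t" r] by auto
  have T2: "P p (q + k * p) r (t + k * r) \<longleftrightarrow> P p q r t" for p q r t k
  proof (induction k rule: int_induct[where k = 0])
    case (step1 i) then show ?case using T[of p "q + i * p" r "t + i * r"] by (simp add: algebra_simps)
  next
    case (step2 i) then show ?case using T[of p "q + (i - 1) * p" r "t + (i - 1) * r"] by (simp add: algebra_simps)
  qed simp
  \<comment> \<open>Conjugation by S turns operations on the second column into operations on the
    first.\<close>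
  have T1: "P (p + k * q) q (r + k * t) t \<longleftrightarrow> P p q r t" for p q r t k
    using T2[of q "-p" "-k" t "-r"] S[of q p t r] S[of q "p + k * q" t "r + k * t"]
    by (simp add: algebra_simps)
  have neg: "P (- p) (- q) (- r) (- t) \<longleftrightarrow> P p q r t" for p q r t
    using S[of q p t r] S[of "-p" q "-r" t] by simp
  have low: "P 1 0 r 1" for r using T1[of 1 r 0 0 1] one by simp
  have unit: "P g 0 r t" if d: "[g * t = 1] (mod N)" for g r t
  proof -
    \<comment> \<open>Adding \<open>t\<close> times the first column to the second produces the
      lower entry \<open>u\<close> and the upper entry \<open>t * g\<close>, which is 1 modulo
      \<open>N\<close>. Subtracting \<open>g - 1\<close> times that column from the first then
      produces the lower entry \<open>s\<close>.\<close>
    define u where "u = t * (1 + r)"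
    define s where "s = r - (g - 1) * u"
    have "[u - s = 1] (mod N)"
    proof -
      have "u - s = g * t * (1 + r) - r" by (simp add: u_def s_def algebra_simps)
      also have "[\<dots> = 1 * (1 + r) - r] (mod N)" by (intro cong_diff cong_mult d cong_refl)
      finally show ?thesis by simp
    qed
    then have "P 1 0 s (u - s)" using cong[OF _ _ low, of 0 "u - s"] by (simp add: cong_sym)
    then have "P 1 1 s u" using T2[of 1 0 1 s "u - s"] by simp
    then have "P g 1 r u" using T1[of 1 "g - 1" 1 s u] by (simp add: s_def)
    then have "P g (t * g) r u" using cong[of 1 "t * g" u u] d by (simp add: cong_sym mult.commute)
    then show ?thesis using T2[of g 0 t r t] by (simp add: u_def algebra_simps)
  qed
  show ?thesis using det
  proof (induction "nat \<bar>q\<bar>" arbitrary: p q r t rule: less_induct)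
    case less
    show ?case
    proof (cases "q = 0")
      case True then show ?thesis using less.prems unit by simp
    next
      case False
      \<comment> \<open>Euclidean step: the remainder of \<open>p\<close> by \<open>q\<close>, up to
        sign, becomes the new upper right entry after an application of S.\<close>
      define k where "k = p div q"
      have "P q (- (p - k * q)) t (- (r - k * t))"
      proof (rule less.hyps)
        have "\<bar>p - k * q\<bar> < \<bar>q\<bar>"
          using False abs_mod_less[of q p] by (simp add: k_def minus_div_mult_eq_mod)
        then show "nat \<bar>- (p - k * q)\<bar> < nat \<bar>q\<bar>" by linarith
        show "[q * - (r - k * t) - - (p - k * q) * t = 1] (mod N)"
          using less.prems by (simp add: algebra_simps)
      qed
      then show ?thesis using S[of q "p - k * q" t "r - k * t"] T1[of "p - k * q" k q "r - k * t" t] by simp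
    qed
  qed
qed

section \<open>The action of S and T\<close>

lemmas zmul_simps = zmul.scale_left_distrib zmul.scale_right_distrib
  zmul.scale_left_diff_distrib zmul.scale_right_diff_distrib algebra_simps

lemma add_grp_subgroup_iff:
  "subgroup H (add_grp :: 'a::ab_group_add monoid) \<longleftrightarrow> 0 \<in> H \<and> (\<forall>x\<in>H. \<forall>y\<in>H. x - y \<in> H)"
proof safe
  assume H: "subgroup H (add_grp :: 'a monoid)"
  show "0 \<in> H" using subgroup.one_closed[OF H] by simp
  fix x y assume "x \<in> H" "y \<in> H"
  then show "x - y \<in> H"
    using subgroup.m_closed[OF H, of x "- y"] subgroup.m_inv_closed[OF H, of y] by simp
next
  assume H: "0 \<in> H" "\<forall>x\<in>H. \<forall>y\<in>H. x - y \<in> H"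
  have m: "- x \<in> H" if "x \<in> H" for x using H that by (metis diff_0)
  show "subgroup H (add_grp :: 'a monoid)"
  proof
    fix x y assume "x \<in> H" "y \<in> H"
    then have "x - (- y) \<in> H" using H m by blast
    then show "x \<otimes>\<^bsub>add_grp\<^esub> y \<in> H" by simp
  qed (use H m in auto)
qed

definition weil_T :: "('d::{finite,ab_group_add} \<Rightarrow> rat_mod_int) \<Rightarrow> (complex, 'd) vec \<Rightarrow> (complex, 'd) vec" where
  "weil_T Q v = (\<chi> \<gamma>. e_mod (Q \<gamma>) * v $ \<gamma>)"

text \<open>The action of S in signature 0.\<close>

definition weil_S :: "('d::{finite,ab_group_add} \<Rightarrow> rat_mod_int) \<Rightarrow> (complex, 'd) vec \<Rightarrow> (complex, 'd) vec" where
  "weil_S Q v = (\<chi> \<beta>. (\<Sum>\<gamma>\<in>UNIV. e_mod (- bilin Q \<beta> \<gamma>) * v $ \<gamma>) / complex_of_real (sqrt (real CARD('d))))"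

lemma linear_weil_T: "Vector_Spaces.linear (*s) (*s) (weil_T Q)"
  by (intro Vector_Spaces.linear_iff[THEN iffD2] conjI allI vec.vector_space_axioms)
     (auto simp: weil_T_def vec_eq_iff algebra_simps)

lemma linear_weil_S: "Vector_Spaces.linear (*s) (*s) (weil_S Q)"
  by (intro Vector_Spaces.linear_iff[THEN iffD2] conjI allI vec.vector_space_axioms)
     (auto simp: weil_S_def vec_eq_iff algebra_simps sum.distrib sum_distrib_left add_divide_distrib)

lemma char_vec_nth: "char_vec K $ \<beta> = (if \<beta> \<in> K then 1 else 0)"
  by (simp add: char_vec_def axis_def sum.delta)

section \<open>Calculus of the quadratic and the bilinear form\<close>

locale disc_form =
  fixes Q :: "'d::{finite,ab_group_add} \<Rightarrow> rat_mod_int"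
  assumes disc: "discriminant_form Q"
begin

abbreviation b where "b \<equiv> bilin Q"

lemma b_add_left: "b (x + y) z = b x z + b y z"
  and b_add_right: "b x (y + z) = b x y + b x z"
  and Q_zmul: "Q (n \<cdot> x) = n\<^sup>2 \<cdot> Q x"
  and nondegenerate: "(\<And>\<beta>. b x \<beta> = 0) \<Longrightarrow> x = 0"
  using disc unfolding discriminant_form_def quadratic_form_def zmul_def by blast+

lemma Q_add: "Q (x + y) = Q x + Q y + b x y"
  by (simp add: bilin_def)

lemma b_commute: "b x y = b y x"
  by (simp add: bilin_def algebra_simps)

lemma b_zmul_left: "b (n \<cdot> x) y = n \<cdot> b x y"
  by (rule additive_zmul[where f = "\<lambda>x. b x y"]) (rule b_add_left)

lemma b_zmul_right: "b x (n \<cdot> y) = n \<cdot> b x y"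
  by (rule additive_zmul) (rule b_add_right)

lemma b_minus_left: "b (- x) y = - b x y"
  using b_zmul_left[of "-1" x y] by simp

lemma b_minus_right: "b x (- y) = - b x y"
  using b_zmul_right[of x "-1" y] by simp

lemma b_zero [simp]: "b 0 y = 0" "b x 0 = 0"
  using b_zmul_left[of 0 x y] b_zmul_right[of x 0 y] by (simp_all add: b_zmul_left[of 0 0 y, simplified])

lemma b_diff_left: "b (x - y) z = b x z - b y z"
  using b_add_left[of x "- y" z] by (simp add: b_minus_left)

lemma b_diff_right: "b x (y - z) = b x y - b x z"
  using b_add_right[of x y "- z"] by (simp add: b_minus_right)

lemmas b_simps = b_add_left b_add_right b_zmul_left b_zmul_right b_minus_left b_minus_right
  b_diff_left b_diff_right

lemma Q_0 [simp]: "Q 0 = 0"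
  using Q_zmul[of 0 0] by simp

end

section \<open>Consequences of a fixed self-dual isotropic subgroup\<close>

locale lagrangian = disc_form Q for Q :: "'d::{finite,ab_group_add} \<Rightarrow> rat_mod_int" +
  fixes H :: "'d set"
  assumes lagr: "H \<in> self_dual_isotropic_subgroups Q"
begin

lemma H_subgroup: "subgroup H add_grp"
  and H_iff: "x \<in> H \<longleftrightarrow> (\<forall>y\<in>H. b x y = 0)"
  and Q_H: "x \<in> H \<Longrightarrow> Q x = 0"
  using lagr unfolding self_dual_isotropic_subgroups_def self_dual_def isotropic_def perp_def by auto

lemma H_0 [simp]: "0 \<in> H"
  and H_diff: "x \<in> H \<Longrightarrow> y \<in> H \<Longrightarrow> x - y \<in> H"
  using H_subgroup unfolding add_grp_subgroup_iff by auto

lemma H_minus: "x \<in> H \<Longrightarrow> - x \<in> H"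
  using H_diff[of 0 x] by simp

text \<open>By self-duality the character attached to \<open>x\<close> is trivial on
  \<open>H\<close> exactly for \<open>x\<close> in \<open>H\<close>. Summation over \<open>H\<close>
  thus cuts out \<open>H\<close> itself.\<close>

lemma sum_H: "(\<Sum>h\<in>H. e_mod (b h x)) = (if x \<in> H then of_nat (card H) else 0)"
  using sum_e_mod_subgroup[OF H_subgroup finite, of "\<lambda>h. b h x"] H_iff[of x] b_commute[of x]
  by (simp add: b_add_left)

lemma sum_UNIV: "(\<Sum>y\<in>UNIV. e_mod (b x y)) = (if x = 0 then of_nat CARD('d) else 0)"
proof -
  have "subgroup UNIV (add_grp :: 'd monoid)" by (simp add: add_grp_subgroup_iff)
  from sum_e_mod_subgroup[OF this finite, of "b x"] show ?thesis
    using nondegenerate[of x] by (auto simp: b_add_right)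
qed

text \<open>The sum of \<open>e_mod (b h y)\<close> over \<open>h\<close> in \<open>H\<close> and
  \<open>y\<close> in D is evaluated in both orders. The normalising constant of S thereby becomes
  \<open>card H\<close>.\<close>

lemma card_H: "(card H)\<^sup>2 = CARD('d)"
proof -
  have "(\<Sum>y\<in>UNIV. \<Sum>h\<in>H. e_mod (b h y)) = of_nat ((card H)\<^sup>2)"
    by (simp add: sum_H sum.If_cases power2_eq_square)
  moreover have "(\<Sum>h\<in>H. \<Sum>y\<in>UNIV. e_mod (b h y)) = of_nat CARD('d)"
    by (simp add: sum_UNIV sum.If_cases)
  ultimately have "of_nat ((card H)\<^sup>2) = (of_nat CARD('d) :: complex)"
    using sum.swap[of "\<lambda>y h. e_mod (b h y)" H UNIV] by (simp only:)
  then show ?thesis unfolding of_nat_eq_iff .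
qed

lemma sqrt_card: "sqrt (real CARD('d)) = real (card H)"
  unfolding card_H[symmetric] by simp

lemma H_nonempty [simp]: "H \<noteq> {}"
  by (metis H_0 empty_iff)

lemma card_H_pos: "card H > 0"
  by (simp add: card_gt_0_iff)

text \<open>The sum is averaged over translations by \<open>H\<close>. Since
  \<open>Q (h + \<gamma>) = Q \<gamma> + b h \<gamma>\<close>, the average over \<open>h\<close>
  kills all \<gamma> outside \<open>H\<close>, and inside \<open>H\<close> the form
  vanishes.\<close>

lemma gauss_sum: "(\<Sum>\<gamma>\<in>UNIV. e_mod (Q \<gamma>)) = of_nat (card H)"
proof -
  have "of_nat (card H) * (\<Sum>\<gamma>\<in>UNIV. e_mod (Q \<gamma>)) = (\<Sum>h\<in>H. \<Sum>\<gamma>\<in>UNIV. e_mod (Q (h + \<gamma>)))"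
  proof -
    have "(\<Sum>\<gamma>\<in>UNIV. e_mod (Q (h + \<gamma>))) = (\<Sum>\<gamma>\<in>UNIV. e_mod (Q \<gamma>))" for h
      by (rule sum.reindex_bij_witness[of _ "\<lambda>\<gamma>. - h + \<gamma>" "\<lambda>\<gamma>. h + \<gamma>"]) auto
    then show ?thesis by simp
  qed
  also have "\<dots> = (\<Sum>\<gamma>\<in>UNIV. \<Sum>h\<in>H. e_mod (Q \<gamma>) * e_mod (b h \<gamma>))"
    by (subst sum.swap) (auto intro!: sum.cong simp: Q_add Q_H e_mod_add)
  also have "\<dots> = of_nat (card H) * of_nat (card H)"
    by (simp add: sum_H flip: sum_distrib_left)
       (simp add: if_distrib[of "\<lambda>z. _ * z"] sum.If_cases Q_H)
  finally show ?thesis using card_H_pos by simp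
qed

lemma signature_0: "signature Q = 0"
proof -
  \<comment> \<open>The normalised Gauss sum is 1, so the definite description in
    \<open>signature\<close> requires that 0 is the only residue in \<open>{0..<8}\<close> with
    exponential 1.\<close>
  have *: "e2pi (of_int s / 8) = 1 \<longleftrightarrow> s = 0" if "s \<in> {0..<8}" for s :: int
  proof -
    have "(of_int s / 8 :: complex) = of_rat (of_int s / 8)" by (simp add: of_rat_divide)
    moreover have "of_int s / 8 \<in> (\<int> :: rat set) \<longleftrightarrow> s = 0"
    proof
      assume "of_int s / 8 \<in> (\<int> :: rat set)"
      then obtain k :: int where "of_int s / 8 = (of_int k :: rat)" by (auto elim: Ints_cases)
      then have "of_int s = (of_int (8 * k) :: rat)" by simp
      then have "s = 8 * k" by (simp only: of_int_eq_iff)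
      then show "s = 0" using that by auto
    qed simp
    ultimately show ?thesis using e2pi_of_rat_eq_1_iff[of "of_int s / 8"] by simp
  qed
  have "(\<Sum>\<gamma>\<in>UNIV. e_mod (Q \<gamma>)) / complex_of_real (sqrt (real CARD('d))) = 1"
    using card_H_pos by (simp add: gauss_sum sqrt_card)
  then show ?thesis unfolding signature_def using *[of 0] * by (intro the_equality) auto
qed

text \<open>The translated and twisted \<open>char_vec H\<close> of the overview. The character is
  evaluated at \<open>\<beta> - x\<close>, and the phase \<open>c\<close> stays in Q/Z, so that S
  and T act by substitution on the triple \<open>(x, y, c)\<close>.\<close>

definition psi :: "'d \<Rightarrow> 'd \<Rightarrow> rat_mod_int \<Rightarrow> (complex, 'd) vec" where
  "psi x y c = (\<chi> \<beta>. if \<beta> - x \<in> H then e_mod (c + b (\<beta> - x) y) else 0)"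

text \<open>On the coset of \<open>x\<close> the form is
  \<open>Q \<beta> = Q x + b (\<beta> - x) x\<close>, because \<open>Q\<close> vanishes on
  \<open>H\<close>. This is a character times a constant.\<close>

lemma weil_T_psi: "weil_T Q (psi x y c) = psi x (y + x) (c + Q x)"
proof (unfold vec_eq_iff, intro allI)
  fix \<beta>
  show "weil_T Q (psi x y c) $ \<beta> = psi x (y + x) (c + Q x) $ \<beta>"
  proof (cases "\<beta> - x \<in> H")
    case True
    have "Q \<beta> = Q x + b (\<beta> - x) x" using Q_add[of "\<beta> - x" x] Q_H[OF True] by simp
    then show ?thesis using True
      by (simp add: weil_T_def psi_def b_add_right algebra_simps flip: e_mod_add)
  qed (simp add: weil_T_def psi_def)
qed

text \<open>The Fourier transform exchanges translation and character: summing over the coset of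
  \<open>x\<close> leaves \<open>e_mod (c - b \<beta> x)\<close> on the coset of \<open>y\<close>.
  The factor \<open>card H\<close> cancels the normalisation.\<close>

lemma weil_S_psi: "weil_S Q (psi x y c) = psi y (- x) (c - b x y)"
proof (unfold vec_eq_iff, intro allI)
  fix \<beta>
  have "(\<Sum>\<gamma>\<in>UNIV. e_mod (- b \<beta> \<gamma>) * psi x y c $ \<gamma>) =
      (\<Sum>\<gamma>\<in>{\<gamma>. \<gamma> - x \<in> H}. e_mod (- b \<beta> \<gamma>) * e_mod (c + b (\<gamma> - x) y))"
    by (intro sum.mono_neutral_cong_right) (auto simp: psi_def)
  also have "\<dots> = (\<Sum>h\<in>H. e_mod (c - b \<beta> x) * e_mod (b h (y - \<beta>)))"
    by (rule sum.reindex_bij_witness[of _ "\<lambda>h. h + x" "\<lambda>\<gamma>. \<gamma> - x"])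
       (auto simp: b_simps b_commute algebra_simps simp flip: e_mod_add)
  also have "\<dots> = (if y - \<beta> \<in> H then e_mod (c - b \<beta> x) * of_nat (card H) else 0)"
    by (simp add: sum_H flip: sum_distrib_left)
  also have "y - \<beta> \<in> H \<longleftrightarrow> \<beta> - y \<in> H" using H_minus[of "y - \<beta>"] H_minus[of "\<beta> - y"] by auto
  finally show "weil_S Q (psi x y c) $ \<beta> = psi y (- x) (c - b x y) $ \<beta>"
    using card_H_pos
    by (simp add: weil_S_def psi_def sqrt_card b_simps b_commute)
qed

lemma char_vec_eq_psi: "char_vec H = psi 0 0 0"
  by (simp add: vec_eq_iff char_vec_nth psi_def)

lemma weil_T_char_vec: "weil_T Q (char_vec H) = char_vec H"
  and weil_S_char_vec: "weil_S Q (char_vec H) = char_vec H"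
  by (simp_all add: char_vec_eq_psi weil_T_psi weil_S_psi)

text \<open>The integer matrix with rows \<open>(p, q)\<close> and \<open>(r, t)\<close> acts on the pair \<open>(x, y)\<close>. Its phase is an
  integral bilinear form with diagonal \<open>(Q x, Q y)\<close> on the lattice of the coefficient vectors, which
  makes S and T act on \<open>phi x y\<close> by permuting the matrices.\<close>

definition phi :: "'d \<Rightarrow> 'd \<Rightarrow> int \<Rightarrow> int \<Rightarrow> int \<Rightarrow> int \<Rightarrow> (complex, 'd) vec" where
  "phi x y p q r t = psi (p \<cdot> x + r \<cdot> y) (q \<cdot> x + t \<cdot> y)
     ((p * q) \<cdot> Q x + (r * t) \<cdot> Q y + (r * q) \<cdot> b x y)"

lemma weil_T_phi: "weil_T Q (phi x y p q r t) = phi x y p (q + p) r (t + r)"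
  unfolding phi_def weil_T_psi
  by (rule arg_cong3[where f = psi]) (simp_all add: Q_add Q_zmul b_simps zmul_simps power2_eq_square)

text \<open>\<open>Q (2 \<cdot> x)\<close> is computed once by homogeneity and once by
  polarisation.\<close>

lemma b_self: "b x x = Q x + Q x"
proof -
  have "4 \<cdot> Q x = 2 \<cdot> Q x + b x x"
    using Q_zmul[of 2 x] Q_add[of x x] zmul.scale_left_distrib[of 1 1 x]
      zmul.scale_left_distrib[of 1 1 "Q x"] by simp
  then show ?thesis using zmul.scale_left_distrib[of 2 2 "Q x"] zmul.scale_left_distrib[of 1 1 "Q x"] by simp
qed

text \<open>The phase loses the pairing of the two columns. By \<open>b_self\<close> this changes
  the coefficients \<open>p * q\<close> and \<open>r * t\<close> of \<open>Q x\<close> and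
  \<open>Q y\<close> into their negatives and the coefficient \<open>r * q\<close> of
  \<open>b x y\<close> into \<open>- (p * t)\<close>.\<close>

lemma weil_S_phi: "weil_S Q (phi x y p q r t) = phi x y q (- p) t (- r)"
  unfolding phi_def weil_S_psi
  by (rule arg_cong3[where f = psi])
     (simp_all add: b_self b_simps b_commute[of y x] zmul_simps zmul.scale_minus_left)

end

section \<open>Invariants as sums of characteristic functions\<close>

lemma sum4_swap:
  fixes f :: "'a \<Rightarrow> 'a \<Rightarrow> 'a \<Rightarrow> 'a \<Rightarrow> 'b::comm_monoid_add"
  shows "(\<Sum>q\<in>I. \<Sum>t\<in>I. \<Sum>p\<in>I. \<Sum>r\<in>I. f p q r t) = (\<Sum>p\<in>I. \<Sum>r\<in>I. \<Sum>q\<in>I. \<Sum>t\<in>I. f p q r t)"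
proof -
  have "(\<Sum>q\<in>I. \<Sum>t\<in>I. \<Sum>p\<in>I. \<Sum>r\<in>I. f p q r t) = (\<Sum>q\<in>I. \<Sum>p\<in>I. \<Sum>t\<in>I. \<Sum>r\<in>I. f p q r t)"
    by (intro sum.cong refl sum.swap)
  also have "\<dots> = (\<Sum>p\<in>I. \<Sum>q\<in>I. \<Sum>t\<in>I. \<Sum>r\<in>I. f p q r t)"
    by (rule sum.swap)
  also have "\<dots> = (\<Sum>p\<in>I. \<Sum>q\<in>I. \<Sum>r\<in>I. \<Sum>t\<in>I. f p q r t)"
    by (intro sum.cong refl sum.swap)
  also have "\<dots> = (\<Sum>p\<in>I. \<Sum>r\<in>I. \<Sum>q\<in>I. \<Sum>t\<in>I. f p q r t)"
    by (intro sum.cong refl sum.swap)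
  finally show ?thesis .
qed

section \<open>The modulus and a criterion for self-duality\<close>

context disc_form
begin

text \<open>The factor 2 only serves to make \<open>N\<close> at least 2.\<close>

definition N :: int where "N = 2 * (int CARD('d))\<^sup>2"

lemma N_pos: "N > 0" and N_ge_2: "N \<ge> 2"
proof -
  have "int CARD('d) \<ge> 1" by (simp add: Suc_le_eq)
  then have "(int CARD('d))\<^sup>2 \<ge> 1" by simp
  then show "N > 0" "N \<ge> 2" by (simp_all add: N_def)
qed

lemma N_zmul [simp]: "N \<cdot> (x :: 'd) = 0"
proof -
  have "N \<cdot> x = (2 * int CARD('d)) \<cdot> int CARD('d) \<cdot> x" by (simp add: N_def power2_eq_square mult.assoc)
  then show ?thesis by (simp only: card_zmul zmul.scale_zero_right)
qed

text \<open>The square of the group order in \<open>N\<close> is what lets the factor be absorbed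
  into the argument of the quadratic map \<open>Q\<close>.\<close>

lemma N_Q [simp]: "N \<cdot> Q x = 0"
proof -
  have "N \<cdot> Q x = 2 \<cdot> Q (int CARD('d) \<cdot> x)" by (simp add: N_def Q_zmul)
  then show ?thesis by (simp add: card_zmul)
qed

lemma N_b [simp]: "N \<cdot> b x y = 0"
  using b_zmul_left[of N x y] by simp

text \<open>S maps \<open>char_vec G\<close> to a positive multiple of the characteristic function
  of \<open>perp Q G\<close>. Comparison of supports gives the claim.\<close>

lemma self_dualI:
  assumes G: "subgroup G add_grp" and S: "weil_S Q (char_vec G) = char_vec G"
  shows "self_dual Q G"
proof -
  have "weil_S Q (char_vec G) $ \<beta> = (if \<beta> \<in> perp Q G then of_nat (card G) else 0) / sqrt (real CARD('d))" for \<beta>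
  proof -
    have "(\<Sum>\<gamma>\<in>UNIV. e_mod (- b \<beta> \<gamma>) * char_vec G $ \<gamma>) = (\<Sum>\<gamma>\<in>G. e_mod (- b \<beta> \<gamma>))"
      by (intro sum.mono_neutral_cong_right) (auto simp: char_vec_nth)
    also have "\<dots> = (if \<beta> \<in> perp Q G then of_nat (card G) else 0)"
      using sum_e_mod_subgroup[OF G finite, of "\<lambda>\<gamma>. - b \<beta> \<gamma>"] by (simp add: b_add_right perp_def)
    finally show ?thesis by (simp add: weil_S_def)
  qed
  moreover have "card G \<noteq> 0" using subgroup.one_closed[OF G] by auto
  ultimately have "\<beta> \<in> G \<longleftrightarrow> \<beta> \<in> perp Q G" for \<beta>
    using arg_cong[OF S, of "\<lambda>v. v $ \<beta>"] by (auto simp: char_vec_nth split: if_splits)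
  then show ?thesis unfolding self_dual_def by blast
qed

end

section \<open>Matrix sums weighted by a character of the determinant\<close>

context lagrangian
begin

lemma phi_cong:
  assumes "[q = q'] (mod N)" "[t = t'] (mod N)"
  shows "phi x y p q r t = phi x y p q' r t'"
proof -
  have "(p * q) \<cdot> Q x = (p * q') \<cdot> Q x" "(r * t) \<cdot> Q y = (r * t') \<cdot> Q y"
       "(r * q) \<cdot> b x y = (r * q') \<cdot> b x y" "q \<cdot> x = q' \<cdot> x" "t \<cdot> y = t' \<cdot> y"
    using assms by (auto intro!: zmul_cong[where N = N] cong_mult)
  then show ?thesis by (simp only: phi_def)
qed

text \<open>For \<open>N \<cdot> c = 0\<close> the weight is a character of the determinant modulo
  \<open>N\<close>, and every such character arises from some \<open>c\<close>.\<close>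

definition det_sum :: "rat_mod_int \<Rightarrow> 'd \<Rightarrow> 'd \<Rightarrow> (complex, 'd) vec" where
  "det_sum c x y = (\<Sum>p\<in>{0..<N}. \<Sum>r\<in>{0..<N}. \<Sum>q\<in>{0..<N}. \<Sum>t\<in>{0..<N}.
     e_mod ((p * t - q * r) \<cdot> c) *s phi x y p q r t)"

text \<open>Right multiplication by S preserves determinants and permutes the matrices modulo
  \<open>N\<close>. The signs disappear by periodicity, and \<open>sum4_swap\<close> undoes the
  exchange of columns.\<close>

lemma weil_S_det_sum:
  assumes c: "N \<cdot> c = 0"
  shows "weil_S Q (det_sum c x y) = det_sum c x y"
proof -
  interpret S: Vector_Spaces.linear "(*s)" "(*s)" "weil_S Q" by (rule linear_weil_S)
  define F where "F p q r t = e_mod ((p * t - q * r) \<cdot> c) *s phi x y p q r t" for p q r t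
  have F: "F p q r t = F p q' r t'" if "[q = q'] (mod N)" "[t = t'] (mod N)" for p q r t q' t'
  proof -
    have "(p * t - q * r) \<cdot> c = (p * t' - q' * r) \<cdot> c"
      using that c by (intro zmul_cong[where N = N] cong_diff cong_mult) auto
    then show ?thesis using phi_cong[OF that] by (simp add: F_def)
  qed
  let ?I = "{0..<N}"
  define X where "X q t = (\<Sum>p\<in>?I. \<Sum>r\<in>?I. F p q r t)" for q t
  have X: "X q t = X q' t'" if "[q = q'] (mod N)" "[t = t'] (mod N)" for q t q' t'
    unfolding X_def by (intro sum.cong refl F that)
  have "weil_S Q (det_sum c x y) = (\<Sum>p\<in>?I. \<Sum>r\<in>?I. X (- p) (- r))"
    by (simp add: det_sum_def X_def S.sum S.scale weil_S_phi F_def algebra_simps)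
  also have "\<dots> = (\<Sum>p\<in>?I. \<Sum>r\<in>?I. X (- p) r)"
    by (intro sum.cong refl sum_periodic_minus N_pos X) auto
  also have "\<dots> = (\<Sum>p\<in>?I. \<Sum>r\<in>?I. X p r)"
    by (intro sum_periodic_minus[of N "\<lambda>p. \<Sum>r\<in>?I. X p r"] sum.cong refl N_pos X) auto
  also have "\<dots> = det_sum c x y"
    unfolding X_def det_sum_def F_def[symmetric] by (rule sum4_swap)
  finally show ?thesis .
qed

text \<open>The first clause is the support condition. In the phase of a summand of
  \<open>det_sum\<close> at \<beta>, the two left-hand sides are the coefficients of
  \<open>q\<close> and of \<open>t\<close>. All three clauses are additive in
  \<open>(\<beta>, p, r)\<close>, so the solutions form a group.\<close>

definition det_cond :: "rat_mod_int \<Rightarrow> 'd \<Rightarrow> 'd \<Rightarrow> 'd \<Rightarrow> int \<Rightarrow> int \<Rightarrow> bool" where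
  "det_cond c x y \<beta> p r \<longleftrightarrow>
     \<beta> - (p \<cdot> x + r \<cdot> y) \<in> H \<and>
     p \<cdot> Q x + r \<cdot> b x y - r \<cdot> c + b (\<beta> - (p \<cdot> x + r \<cdot> y)) x = 0 \<and>
     r \<cdot> Q y + p \<cdot> c + b (\<beta> - (p \<cdot> x + r \<cdot> y)) y = 0"

lemma det_cond_0: "det_cond c x y 0 0 0"
  by (simp add: det_cond_def)

lemma det_cond_diff:
  assumes "det_cond c x y \<beta> p r" "det_cond c x y \<beta>' p' r'"
  shows "det_cond c x y (\<beta> - \<beta>') (p - p') (r - r')"
proof -
  have eq: "\<beta> - \<beta>' - ((p - p') \<cdot> x + (r - r') \<cdot> y) = (\<beta> - (p \<cdot> x + r \<cdot> y)) - (\<beta>' - (p' \<cdot> x + r' \<cdot> y))"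
    by (simp add: zmul_simps)
  have "(p - p') \<cdot> Q x + (r - r') \<cdot> b x y - (r - r') \<cdot> c +
      b ((\<beta> - (p \<cdot> x + r \<cdot> y)) - (\<beta>' - (p' \<cdot> x + r' \<cdot> y))) x =
    (p \<cdot> Q x + r \<cdot> b x y - r \<cdot> c + b (\<beta> - (p \<cdot> x + r \<cdot> y)) x) -
    (p' \<cdot> Q x + r' \<cdot> b x y - r' \<cdot> c + b (\<beta>' - (p' \<cdot> x + r' \<cdot> y)) x)"
    by (simp only: b_diff_left) (simp add: zmul_simps)
  moreover have "(r - r') \<cdot> Q y + (p - p') \<cdot> c +
      b ((\<beta> - (p \<cdot> x + r \<cdot> y)) - (\<beta>' - (p' \<cdot> x + r' \<cdot> y))) y =
    (r \<cdot> Q y + p \<cdot> c + b (\<beta> - (p \<cdot> x + r \<cdot> y)) y) -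
    (r' \<cdot> Q y + p' \<cdot> c + b (\<beta>' - (p' \<cdot> x + r' \<cdot> y)) y)"
    by (simp only: b_diff_left) (simp add: zmul_simps)
  ultimately show ?thesis
    using assms unfolding det_cond_def eq by (auto intro: H_diff)
qed

text \<open>The solutions \<open>(p, r)\<close> over any attained \<beta> form a translate of those
  over 0, so their number does not depend on \<beta>.\<close>

lemma det_cond_shift:
  assumes "det_cond c x y \<beta>' p' r'"
  shows "det_cond c x y (\<beta> + \<beta>') (p + p') (r + r') \<longleftrightarrow> det_cond c x y \<beta> p r"
proof
  assume "det_cond c x y (\<beta> + \<beta>') (p + p') (r + r')"
  from det_cond_diff[OF this assms] show "det_cond c x y \<beta> p r" by simp
next
  assume *: "det_cond c x y \<beta> p r"
  have "det_cond c x y (- \<beta>') (- p') (- r')"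
    using det_cond_diff[OF det_cond_0 assms] by simp
  from det_cond_diff[OF * this] show "det_cond c x y (\<beta> + \<beta>') (p + p') (r + r')" by simp
qed

lemma det_cond_cong:
  assumes "[p = p'] (mod N)" "[r = r'] (mod N)" "N \<cdot> c = 0"
  shows "det_cond c x y \<beta> p r = det_cond c x y \<beta> p' r'"
proof -
  have "p \<cdot> x = p' \<cdot> x" "r \<cdot> y = r' \<cdot> y" "p \<cdot> Q x = p' \<cdot> Q x" "r \<cdot> Q y = r' \<cdot> Q y"
    "r \<cdot> b x y = r' \<cdot> b x y" "p \<cdot> c = p' \<cdot> c" "r \<cdot> c = r' \<cdot> c"
    using assms by (auto intro!: zmul_cong[where N = N])
  then show ?thesis by (simp only: det_cond_def)
qed

text \<open>Summing over the second column of the matrix imposes the two equations of \<open>det_cond\<close> on the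
  first one.\<close>

lemma det_sum_nth:
  assumes c: "N \<cdot> c = 0"
  shows "det_sum c x y $ \<beta> = (of_int N)\<^sup>2 *
    of_nat (\<Sum>p\<in>{0..<N}. \<Sum>r\<in>{0..<N}. if det_cond c x y \<beta> p r then 1 else 0)"
proof -
  have "(\<Sum>q\<in>{0..<N}. \<Sum>t\<in>{0..<N}. e_mod ((p * t - q * r) \<cdot> c) * phi x y p q r t $ \<beta>) =
      (if det_cond c x y \<beta> p r then (of_int N)\<^sup>2 else 0)" for p r
  proof (cases "\<beta> - (p \<cdot> x + r \<cdot> y) \<in> H")
    case True
    define h where "h = \<beta> - (p \<cdot> x + r \<cdot> y)"
    define u where "u = p \<cdot> Q x + r \<cdot> b x y - r \<cdot> c + b h x"
    define v where "v = r \<cdot> Q y + p \<cdot> c + b h y"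
    have N: "N \<cdot> u = 0" "N \<cdot> v = 0"
    proof -
      have "N \<cdot> k \<cdot> z = 0" if "N \<cdot> z = 0" for k and z :: rat_mod_int
        using that zmul.scale_left_commute[of N k z] by simp
      then show "N \<cdot> u = 0" "N \<cdot> v = 0"
        using c by (simp_all add: u_def v_def zmul.scale_right_distrib zmul.scale_right_diff_distrib
            del: zmul.scale_scale)
    qed
    have "e_mod ((p * t - q * r) \<cdot> c) * phi x y p q r t $ \<beta> = e_mod (q \<cdot> u) * e_mod (t \<cdot> v)" for q t
      using True by (simp add: phi_def psi_def u_def v_def b_add_right b_zmul_right zmul_simps
          flip: e_mod_add h_def)
    then have "(\<Sum>q\<in>{0..<N}. \<Sum>t\<in>{0..<N}. e_mod ((p * t - q * r) \<cdot> c) * phi x y p q r t $ \<beta>) =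
        (\<Sum>q\<in>{0..<N}. e_mod (q \<cdot> u)) * (\<Sum>t\<in>{0..<N}. e_mod (t \<cdot> v))"
      by (simp add: sum_product)
    then show ?thesis
      using True unfolding sum_e_mod_zmul[OF N_pos N(1)] sum_e_mod_zmul[OF N_pos N(2)]
      by (auto simp: det_cond_def u_def v_def h_def power2_eq_square)
  qed (simp add: phi_def psi_def det_cond_def)
  note inner = this
  have "det_sum c x y $ \<beta> = (\<Sum>p\<in>{0..<N}. \<Sum>r\<in>{0..<N}. \<Sum>q\<in>{0..<N}. \<Sum>t\<in>{0..<N}.
      e_mod ((p * t - q * r) \<cdot> c) * phi x y p q r t $ \<beta>)"
    by (simp add: det_sum_def)
  then show ?thesis
    by (simp only: inner) (simp add: sum_distrib_left if_distrib cong: if_cong)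
qed

lemma det_sum_in_span:
  assumes c: "N \<cdot> c = 0"
  shows "det_sum c x y \<in> vec.span (char_vec ` self_dual_isotropic_subgroups Q)"
proof -
  interpret S: Vector_Spaces.linear "(*s)" "(*s)" "weil_S Q" by (rule linear_weil_S)
  define k :: "'d \<Rightarrow> nat" where
    "k \<beta> = (\<Sum>p\<in>{0..<N}. \<Sum>r\<in>{0..<N}. if det_cond c x y \<beta> p r then 1 else 0)" for \<beta>
  \<comment> \<open>The support of \<open>det_sum c x y\<close>. The coefficient at \<beta> is
    \<open>N\<close> squared times the number \<open>k \<beta>\<close> of solutions modulo
    \<open>N\<close>.\<close>
  define G where "G = {\<beta>. \<exists>p r. det_cond c x y \<beta> p r}"
  have G: "subgroup G add_grp"
    unfolding add_grp_subgroup_iff G_def using det_cond_0 det_cond_diff by blast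
  have k_G: "k \<beta> = k 0" if "\<beta> \<in> G" for \<beta>
  proof -
    obtain p' r' where *: "det_cond c x y \<beta> p' r'" using \<open>\<beta> \<in> G\<close> G_def by auto
    define f :: "int \<Rightarrow> int \<Rightarrow> nat" where "f p r = (if det_cond c x y \<beta> p r then 1 else 0)" for p r
    have f: "f p r = f p' r'" if "[p = p'] (mod N)" "[r = r'] (mod N)" for p p' r r'
      unfolding f_def using det_cond_cong[OF that c] by simp
    have "k 0 = (\<Sum>p\<in>{0..<N}. \<Sum>r\<in>{0..<N}. f (p + p') (r + r'))"
      using det_cond_shift[OF *, of 0] by (simp add: k_def f_def)
    also have "\<dots> = (\<Sum>p\<in>{0..<N}. \<Sum>r\<in>{0..<N}. f (p + p') r)"
      by (intro sum.cong refl sum_periodic_shift N_pos f) auto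
    also have "\<dots> = (\<Sum>p\<in>{0..<N}. \<Sum>r\<in>{0..<N}. f p r)"
      by (intro sum_periodic_shift[of N "\<lambda>p. \<Sum>r\<in>{0..<N}. f p r"] sum.cong refl N_pos f) auto
    finally show ?thesis by (simp add: k_def f_def)
  qed
  have k_0: "k 0 \<noteq> 0"
    using N_pos det_cond_0 by (auto simp: k_def intro!: bexI[of _ 0])
  define a :: complex where "a = (of_int N)\<^sup>2 * of_nat (k 0)"
  have a: "a \<noteq> 0" using N_pos k_0 by (simp add: a_def)
  have eq: "det_sum c x y = a *s char_vec G"
  proof (unfold vec_eq_iff, intro allI)
    fix \<beta>
    have "k \<beta> = 0" if "\<beta> \<notin> G" using that by (simp add: k_def G_def)
    then show "det_sum c x y $ \<beta> = (a *s char_vec G) $ \<beta>"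
      unfolding det_sum_nth[OF c] k_def[symmetric] using k_G[of \<beta>] by (auto simp: char_vec_nth a_def)
  qed
  \<comment> \<open>Invariance of \<open>det_sum\<close> under S passes to \<open>char_vec G\<close>
    because the multiple \<open>a\<close> is nonzero: \<open>det_cond\<close> has the zero solution
    at 0.\<close>
  have "a *s weil_S Q (char_vec G) = a *s char_vec G"
    using weil_S_det_sum[OF c, of x y] eq by (simp add: S.scale)
  then have "self_dual Q G"
    using a by (intro self_dualI G) simp
  moreover have "Q \<beta> = 0" if "\<beta> \<in> G" for \<beta>
  proof -
    obtain p r where d: "det_cond c x y \<beta> p r" using \<open>\<beta> \<in> G\<close> G_def by auto
    define h where "h = \<beta> - (p \<cdot> x + r \<cdot> y)"
    have h: "h \<in> H" "p \<cdot> Q x + r \<cdot> b x y - r \<cdot> c + b h x = 0" "r \<cdot> Q y + p \<cdot> c + b h y = 0"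
      using d by (simp_all add: det_cond_def h_def)
    have "\<beta> = h + (p \<cdot> x + r \<cdot> y)" by (simp add: h_def)
    \<comment> \<open>\<open>Q \<beta>\<close> is \<open>p\<close> times the first equation plus
      \<open>r\<close> times the second. The terms in \<open>c\<close> cancel.\<close>
    then have "Q \<beta> = p \<cdot> (p \<cdot> Q x + r \<cdot> b x y - r \<cdot> c + b h x) + r \<cdot> (r \<cdot> Q y + p \<cdot> c + b h y)"
      using Q_H[OF h(1)] by (simp add: Q_add Q_zmul b_simps zmul_simps power2_eq_square)
    then show ?thesis by (simp add: h)
  qed
  ultimately have "G \<in> self_dual_isotropic_subgroups Q"
    using G unfolding self_dual_isotropic_subgroups_def self_dual_def isotropic_def by blast
  then show ?thesis unfolding eq by (intro vec.span_scale vec.span_base imageI)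
qed

text \<open>Fourier inversion on the residues modulo \<open>N\<close> writes the indicator of
  determinant 1 through the characters given by the multiples \<open>k \<cdot> c\<close>.\<close>

lemma sum_phi_det_one_in_span:
  "(\<Sum>p\<in>{0..<N}. \<Sum>r\<in>{0..<N}. \<Sum>q\<in>{0..<N}. \<Sum>t\<in>{0..<N}.
      (if [p * t - q * r = 1] (mod N) then 1 else 0) *s phi x y p q r t)
    \<in> vec.span (char_vec ` self_dual_isotropic_subgroups Q)" (is "?s \<in> _")
proof -
  let ?I = "{0..<N}"
  \<comment> \<open>The class of \<open>1 / N\<close> has exact order \<open>N\<close>, so its
    multiples give all characters modulo \<open>N\<close>.\<close>
  define c where "c = abs_rat_mod_int (1 / of_int N)"
  have c_iff: "d \<cdot> c = 0 \<longleftrightarrow> N dvd d" for d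
  proof -
    have "d \<cdot> c = 0 \<longleftrightarrow> of_int d / of_int N \<in> (\<int> :: rat set)"
      by (simp add: c_def zmul_abs_rat_mod_int zero_rat_mod_int_def rat_mod_int.abs_eq_iff)
    also have "\<dots> \<longleftrightarrow> N dvd d"
      using N_pos of_int_div_of_int_in_Ints_iff[of d N, where ?'a = rat] by simp
    finally show ?thesis .
  qed
  have fourier: "(\<Sum>k\<in>?I. e_mod (- (k \<cdot> c)) * e_mod (d \<cdot> k \<cdot> c)) =
      of_int N * (if [d = 1] (mod N) then 1 else 0)" for d
  proof -
    have "(\<Sum>k\<in>?I. e_mod (- (k \<cdot> c)) * e_mod (d \<cdot> k \<cdot> c)) = (\<Sum>k\<in>?I. e_mod (k \<cdot> (d - 1) \<cdot> c))"
      by (simp add: zmul_simps flip: e_mod_add)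
    also have "\<dots> = (if (d - 1) \<cdot> c = 0 then of_int N else 0)"
      by (rule sum_e_mod_zmul[OF N_pos]) (simp add: c_iff)
    finally show ?thesis by (simp add: c_iff cong_iff_dvd_diff)
  qed
  have "of_int N *s ?s = (\<Sum>k\<in>?I. e_mod (- (k \<cdot> c)) *s det_sum (k \<cdot> c) x y)"
  proof -
    have "(\<Sum>k\<in>?I. e_mod (- (k \<cdot> c)) *s det_sum (k \<cdot> c) x y) =
      (\<Sum>k\<in>?I. \<Sum>p\<in>?I. \<Sum>r\<in>?I. \<Sum>q\<in>?I. \<Sum>t\<in>?I.
        (e_mod (- (k \<cdot> c)) * e_mod ((p * t - q * r) \<cdot> k \<cdot> c)) *s phi x y p q r t)"
      by (simp add: det_sum_def vec.scale_sum_right del: zmul.scale_scale)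
    also have "\<dots> = (\<Sum>p\<in>?I. \<Sum>r\<in>?I. \<Sum>q\<in>?I. \<Sum>t\<in>?I. \<Sum>k\<in>?I.
        (e_mod (- (k \<cdot> c)) * e_mod ((p * t - q * r) \<cdot> k \<cdot> c)) *s phi x y p q r t)"
      by (subst sum.swap, rule sum.cong[OF refl])+ (rule refl)
    also have "\<dots> = of_int N *s ?s"
      by (simp only: vec.scale_sum_left[symmetric] fourier) (simp add: vec.scale_sum_right)
    finally show ?thesis by simp
  qed
  also have "\<dots> \<in> vec.span (char_vec ` self_dual_isotropic_subgroups Q)"
    by (intro vec.span_sum vec.span_scale det_sum_in_span) (simp add: c_iff)
  finally have "inverse (of_int N) *s (of_int N *s ?s) \<in> vec.span (char_vec ` self_dual_isotropic_subgroups Q)"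
    by (rule vec.span_scale)
  then show ?thesis using N_pos by simp
qed

text \<open>At the identity matrix the phase is 0. Summing over all characters \<open>y\<close>
  isolates the point \<open>x\<close> by nondegeneracy, giving \<open>CARD('d)\<close> times the
  basis vector of \<open>x\<close>.\<close>

lemma phi_expansion:
  "(\<Sum>x\<in>UNIV. \<Sum>y\<in>UNIV. (v $ x / of_nat CARD('d)) *s phi x y 1 0 0 1) = v"
proof (unfold vec_eq_iff, intro allI)
  fix \<beta>
  have "(\<Sum>y\<in>UNIV. (v $ x / of_nat CARD('d)) * phi x y 1 0 0 1 $ \<beta>) = (if x = \<beta> then v $ x else 0)" for x
  proof (cases "\<beta> - x \<in> H")
    case True
    then show ?thesis
      using sum_UNIV[of "\<beta> - x"] by (simp add: phi_def psi_def flip: sum_distrib_left sum_divide_distrib)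
  next
    case False
    then have "x \<noteq> \<beta>" by auto
    then show ?thesis using False by (simp add: phi_def psi_def)
  qed
  then show "(\<Sum>x\<in>UNIV. \<Sum>y\<in>UNIV. (v $ x / of_nat CARD('d)) *s phi x y 1 0 0 1) $ \<beta> = v $ \<beta>" by simp
qed

text \<open>By \<open>phi_expansion\<close> it suffices to consider the vectors
  \<open>phi x y 1 0 0 1\<close>, where S acts on the matrix with square -1.\<close>

lemma weil_S_order_4: "weil_S Q (weil_S Q (weil_S Q (weil_S Q v))) = v"
proof -
  interpret S: Vector_Spaces.linear "(*s)" "(*s)" "weil_S Q" by (rule linear_weil_S)
  have "weil_S Q (weil_S Q (weil_S Q (weil_S Q (\<Sum>x\<in>UNIV. \<Sum>y\<in>UNIV. (v $ x / of_nat CARD('d)) *s phi x y 1 0 0 1)))) =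
      (\<Sum>x\<in>UNIV. \<Sum>y\<in>UNIV. (v $ x / of_nat CARD('d)) *s phi x y 1 0 0 1)"
    by (simp add: S.sum S.scale weil_S_phi)
  then show ?thesis unfolding phi_expansion .
qed

lemma invariant_in_span:
  assumes T: "weil_T Q v = v" and S: "weil_S Q v = v"
  shows "v \<in> vec.span (char_vec ` self_dual_isotropic_subgroups Q)" (is "_ \<in> ?span")
proof -
  interpret T: Vector_Spaces.linear "(*s)" "(*s)" "weil_T Q" by (rule linear_weil_T)
  interpret S: Vector_Spaces.linear "(*s)" "(*s)" "weil_S Q" by (rule linear_weil_S)
  let ?I = "{0..<N}"
  \<comment> \<open>The expansion of \<open>v\<close> with the identity matrix replaced by an
    arbitrary one. S and T still act by right multiplication.\<close>
  define L where "L p q r t = (\<Sum>x\<in>UNIV. \<Sum>y\<in>UNIV. (v $ x / of_nat CARD('d)) *s phi x y p q r t)" for p q r t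
  have L_one: "L 1 0 0 1 = v"
    by (simp only: L_def phi_expansion)
  have LT: "weil_T Q (L p q r t) = L p (q + p) r (t + r)" for p q r t
    by (simp add: L_def T.sum T.scale weil_T_phi)
  have L_T: "L p (q + p) r (t + r) = v \<longleftrightarrow> L p q r t = v" for p q r t
  proof -
    \<comment> \<open>The induction principle asks for an equivalence under T, so
      \<open>weil_T Q\<close> must be cancelled as well as applied.\<close>
    have "inj (weil_T Q)" by (auto simp: inj_def weil_T_def vec_eq_iff)
    then show ?thesis using T unfolding LT[symmetric] by (metis injD)
  qed
  have LS: "weil_S Q (L p q r t) = L q (- p) t (- r)" for p q r t
    by (simp add: L_def S.sum S.scale weil_S_phi)
  have L_S: "L q (- p) t (- r) = v" if "L p q r t = v" for p q r t
    using S that LS[of p q r t] by simp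
  have L_cong: "L p q r t = L p q' r t'" if "[q = q'] (mod N)" "[t = t'] (mod N)" for p q r t q' t'
    using phi_cong[OF that] by (simp add: L_def)
  \<comment> \<open>Invariance makes \<open>L\<close> equal to \<open>v\<close> on the whole orbit
    of the identity, which comprises all matrices of determinant 1 modulo \<open>N\<close>.\<close>
  have L: "L p q r t = v" if "[p * t - q * r = 1] (mod N)" for p q r t
    by (rule SL2_column_induct[where P = "\<lambda>p q r t. L p q r t = v", OF L_one L_T L_S _ that])
       (simp_all add: L_cong[symmetric])
  define n :: nat where
    "n = (\<Sum>p\<in>?I. \<Sum>r\<in>?I. \<Sum>q\<in>?I. \<Sum>t\<in>?I. if [p * t - q * r = 1] (mod N) then 1 else 0)"
  have "n \<noteq> 0"
  proof -
    \<comment> \<open>The identity matrix is counted. Its entries lie in the range because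
      \<open>N \<ge> 2\<close>.\<close>
    have "\<exists>p\<in>?I. \<exists>r\<in>?I. \<exists>q\<in>?I. \<exists>t\<in>?I. [p * t - q * r = 1] (mod N)"
      by (rule bexI[of _ 1], rule bexI[of _ 0], rule bexI[of _ 0], rule bexI[of _ 1])
         (use N_ge_2 in auto)
    then show ?thesis by (auto simp: n_def)
  qed
  \<comment> \<open>Averaging: \<open>v\<close> is added once for each matrix of determinant 1.
    Expanding \<open>L\<close> and exchanging sums reduces this to the sums of
    \<open>phi x y\<close>.\<close>
  have "of_nat n *s v = (\<Sum>p\<in>?I. \<Sum>r\<in>?I. \<Sum>q\<in>?I. \<Sum>t\<in>?I.
      (if [p * t - q * r = 1] (mod N) then 1 else 0) *s L p q r t)"
    unfolding n_def of_nat_sum vec.scale_sum_left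
    by (intro sum.cong refl) (simp add: L)
  also have "\<dots> = (\<Sum>x\<in>UNIV. \<Sum>y\<in>UNIV. (v $ x / of_nat CARD('d)) *s
      (\<Sum>p\<in>?I. \<Sum>r\<in>?I. \<Sum>q\<in>?I. \<Sum>t\<in>?I.
        (if [p * t - q * r = 1] (mod N) then 1 else 0) *s phi x y p q r t))"
  proof -
    have sw: "(\<Sum>p\<in>?I. \<Sum>x\<in>UNIV. \<Sum>y\<in>UNIV. f x y p) = (\<Sum>x\<in>UNIV. \<Sum>y\<in>UNIV. \<Sum>p\<in>?I. f x y p)"
      for f :: "'d \<Rightarrow> 'd \<Rightarrow> int \<Rightarrow> (complex, 'd) vec"
      by (subst sum.swap) (intro sum.cong refl sum.swap)
    show ?thesis
      by (simp only: L_def vec.scale_sum_right sw vec.scale_left_commute)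
  qed
  also have "\<dots> \<in> ?span"
    by (intro vec.span_sum vec.span_scale sum_phi_det_one_in_span)
  finally have "inverse (of_nat n) *s (of_nat n *s v) \<in> ?span"
    by (rule vec.span_scale)
  then show ?thesis using \<open>n \<noteq> 0\<close> by simp
qed

end

section \<open>The metaplectic cover\<close>

abbreviation mat2 :: "int \<Rightarrow> int \<Rightarrow> int \<Rightarrow> int \<Rightarrow> int^2^2" where
  "mat2 p q r t \<equiv> vector [vector [p, q], vector [r, t]]"

lemma mat2_cases: obtains p q r t where "M = mat2 p q r t"
proof
  show "M = mat2 (M$1$1) (M$1$2) (M$2$1) (M$2$2)"
    by (simp add: vec_eq_iff forall_2)
qed

lemma mat2_mult:
  "mat2 p q r t ** mat2 p' q' r' t' =
    mat2 (p * p' + q * r') (p * q' + q * t') (r * p' + t * r') (r * q' + t * t')"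
  by (simp add: vec_eq_iff forall_2 matrix_matrix_mult_def sum_2)

lemma mat2_one: "mat 1 = mat2 1 0 0 1"
  by (simp add: vec_eq_iff forall_2 mat_def)

lemma SL2Z_simps [simp]:
  "carrier SL2Z = {M. det M = 1}" "M \<otimes>\<^bsub>SL2Z\<^esub> M' = M ** M'"
  by (simp_all add: SL2Z_def)

lemma Mp2Z_carrier: "(M, \<phi>) \<in> carrier Mp2Z \<longleftrightarrow> det M = 1 \<and> \<phi> \<in> extensional upper_half_plane \<and>
    \<phi> holomorphic_on upper_half_plane \<and>
    (\<forall>\<tau>\<in>upper_half_plane. (\<phi> \<tau>)^2 = of_int (M$2$1) * \<tau> + of_int (M$2$2))"
  by (simp add: Mp2Z_def)

lemma Mp2Z_mult: "(M, \<phi>) \<otimes>\<^bsub>Mp2Z\<^esub> (M', \<phi>') =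
    (M ** M', \<lambda>\<tau>\<in>upper_half_plane. \<phi> (moebius_map M' \<tau>) * \<phi>' \<tau>)"
  by (simp add: Mp2Z_def)

lemma denominator_nonzero:
  assumes "det (M :: int^2^2) = 1" "\<tau> \<in> upper_half_plane"
  shows "of_int (M$2$1) * \<tau> + of_int (M$2$2) \<noteq> (0 :: complex)"
proof
  assume 0: "of_int (M$2$1) * \<tau> + of_int (M$2$2) = (0 :: complex)"
  then have "Im (of_int (M$2$1) * \<tau> + of_int (M$2$2)) = 0" by simp
  then have "M$2$1 = 0" using assms(2) by (simp add: upper_half_plane_def)
  then show False using 0 assms(1) by (simp add: det_2)
qed

lemma moebius_map_upper_half_plane:
  assumes "det M = 1" "\<tau> \<in> upper_half_plane"
  shows "moebius_map M \<tau> \<in> upper_half_plane"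
proof -
  have det: "M$1$1 * M$2$2 - M$1$2 * M$2$1 = 1" using assms(1) by (simp add: det_2)
  have d: "real_of_int (M$1$1) * M$2$2 - real_of_int (M$1$2) * M$2$1 = 1"
    using arg_cong[OF det, of real_of_int] by simp
  \<comment> \<open>The sign of the imaginary part of a quotient is that of the numerator times the
    conjugate denominator. Here this product has imaginary part \<open>det M\<close> times
    \<open>Im \<tau>\<close>.\<close>
  have "Im ((of_int (M$1$1) * \<tau> + of_int (M$1$2)) * cnj (of_int (M$2$1) * \<tau> + of_int (M$2$2))) =
      (real_of_int (M$1$1) * M$2$2 - real_of_int (M$1$2) * M$2$1) * Im \<tau>"
    by (simp add: algebra_simps)
  then show ?thesis
    using assms(2) unfolding d by (simp add: upper_half_plane_def moebius_map_def Im_complex_div_gt_0 del: complex_cnj_add)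
qed

lemma moebius_map_holomorphic:
  assumes "det M = 1"
  shows "moebius_map M holomorphic_on upper_half_plane"
  unfolding moebius_map_def by (intro holomorphic_intros denominator_nonzero assms)

text \<open>The squares of the roots multiply by the cocycle identity for the denominators
  \<open>of_int (M$2$1) * \<tau> + of_int (M$2$2)\<close>.\<close>

lemma Mp2Z_mult_closed:
  assumes "g \<in> carrier Mp2Z" "h \<in> carrier Mp2Z"
  shows "g \<otimes>\<^bsub>Mp2Z\<^esub> h \<in> carrier Mp2Z"
proof -
  obtain M \<phi> M' \<phi>' where gh: "g = (M, \<phi>)" "h = (M', \<phi>')" by (cases g, cases h)
  have M: "det M = 1" "\<phi> holomorphic_on upper_half_plane"
      "\<And>\<tau>. \<tau> \<in> upper_half_plane \<Longrightarrow> (\<phi> \<tau>)^2 = of_int (M$2$1) * \<tau> + of_int (M$2$2)"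
    and M': "det M' = 1" "\<phi>' holomorphic_on upper_half_plane"
      "\<And>\<tau>. \<tau> \<in> upper_half_plane \<Longrightarrow> (\<phi>' \<tau>)^2 = of_int (M'$2$1) * \<tau> + of_int (M'$2$2)"
    using assms by (auto simp: gh Mp2Z_carrier)
  have "(\<lambda>\<tau>. \<phi> (moebius_map M' \<tau>) * \<phi>' \<tau>) holomorphic_on upper_half_plane"
    using holomorphic_on_compose_gen[OF moebius_map_holomorphic[OF M'(1)] M(2)]
      moebius_map_upper_half_plane[OF M'(1)] M'(2)
    by (intro holomorphic_on_mult) (auto simp: o_def)
  then have hol: "(\<lambda>\<tau>\<in>upper_half_plane. \<phi> (moebius_map M' \<tau>) * \<phi>' \<tau>) holomorphic_on upper_half_plane"
    by (rule holomorphic_transform) simp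
  have "(\<phi> (moebius_map M' \<tau>) * \<phi>' \<tau>)\<^sup>2 = of_int ((M ** M')$2$1) * \<tau> + of_int ((M ** M')$2$2)"
    if "\<tau> \<in> upper_half_plane" for \<tau>
  proof -
    define D where "D = of_int (M'$2$1) * \<tau> + complex_of_int (M'$2$2)"
    have "D \<noteq> 0" unfolding D_def using denominator_nonzero[OF M'(1) that] .
    have "(\<phi> (moebius_map M' \<tau>) * \<phi>' \<tau>)\<^sup>2 = (of_int (M$2$1) * moebius_map M' \<tau> + of_int (M$2$2)) * D"
      using M(3)[OF moebius_map_upper_half_plane[OF M'(1) that]] M'(3)[OF that]
      by (simp add: power_mult_distrib D_def)
    also have "\<dots> = of_int (M$2$1) * (of_int (M'$1$1) * \<tau> + of_int (M'$1$2)) + of_int (M$2$2) * D"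
      using \<open>D \<noteq> 0\<close> by (simp add: moebius_map_def distrib_right flip: D_def)
    finally show ?thesis by (simp add: D_def matrix_matrix_mult_def sum_2 algebra_simps)
  qed
  then show ?thesis
    using hol M(1) M'(1) by (simp add: gh Mp2Z_mult Mp2Z_carrier det_mul)
qed

text \<open>A choice of lift for each matrix. For the lower row (0, -1) the radicand is the constant
  -1 on the branch cut of \<open>csqrt\<close>, so the root is given as a constant. For all other
  lower rows in determinant 1 the radicand avoids the cut.\<close>

definition Mp2Z_lift :: "int^2^2 \<Rightarrow> mp2_elem" where
  "Mp2Z_lift M = (M, \<lambda>\<tau>\<in>upper_half_plane. if M$2$1 = 0 \<and> M$2$2 = -1 then \<i>
     else csqrt (of_int (M$2$1) * \<tau> + of_int (M$2$2)))"

lemma fst_Mp2Z_lift [simp]: "fst (Mp2Z_lift M) = M"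
  by (simp add: Mp2Z_lift_def)

lemma Mp2Z_lift_carrier:
  assumes "det M = 1"
  shows "Mp2Z_lift M \<in> carrier Mp2Z"
proof -
  have nonpos: "of_int (M$2$1) * \<tau> + of_int (M$2$2) \<notin> (\<real>\<^sub>\<le>\<^sub>0 :: complex set)"
    if "\<tau> \<in> upper_half_plane" "\<not> (M$2$1 = 0 \<and> M$2$2 = -1)" for \<tau>
  proof (cases "M$2$1 = 0")
    case True
    then have "M$2$2 = 1" using assms that(2) by (auto simp: det_2 zmult_eq_1_iff)
    then show ?thesis using True by simp
  next
    case False
    then show ?thesis using that by (simp add: complex_nonpos_Reals_iff upper_half_plane_def)
  qed
  have "(\<lambda>\<tau>. if M$2$1 = 0 \<and> M$2$2 = -1 then \<i> else csqrt (of_int (M$2$1) * \<tau> + of_int (M$2$2)))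
      holomorphic_on upper_half_plane"
  proof (cases "M$2$1 = 0 \<and> M$2$2 = -1")
    case False
    then show ?thesis by (simp only: if_False) (intro holomorphic_intros nonpos)
  qed simp
  then have "snd (Mp2Z_lift M) holomorphic_on upper_half_plane"
    unfolding Mp2Z_lift_def snd_conv by (rule holomorphic_transform) simp
  then show ?thesis using assms by (simp add: Mp2Z_lift_def Mp2Z_carrier)
qed

lemma Mp2Z_T_carrier: "Mp2Z_T \<in> carrier Mp2Z"
proof -
  have "(\<lambda>\<tau>\<in>upper_half_plane. 1 :: complex) holomorphic_on upper_half_plane"
    by (rule holomorphic_transform[of "\<lambda>_. 1"]) auto
  then show ?thesis by (simp add: Mp2Z_T_def Mp2Z_carrier det_2)
qed

lemma Mp2Z_S_carrier: "Mp2Z_S \<in> carrier Mp2Z"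
proof -
  have "csqrt holomorphic_on upper_half_plane"
    by (rule holomorphic_on_subset[OF holomorphic_on_csqrt])
       (auto simp: upper_half_plane_def complex_nonpos_Reals_iff)
  then have "(\<lambda>\<tau>\<in>upper_half_plane. csqrt \<tau>) holomorphic_on upper_half_plane"
    by (rule holomorphic_transform) auto
  then show ?thesis by (simp add: Mp2Z_S_def Mp2Z_carrier det_2)
qed

definition Mp2Z_sign :: mp2_elem where
  "Mp2Z_sign = (mat 1, \<lambda>\<tau>\<in>upper_half_plane. - 1)"

text \<open>The square of S lies over minus the identity, which fixes every \<tau>. Squaring again
  squares its root function \<phi>, whose square is -1 whichever root it is.\<close>

lemma Mp2Z_S_power_4:
  "(Mp2Z_S \<otimes>\<^bsub>Mp2Z\<^esub> Mp2Z_S) \<otimes>\<^bsub>Mp2Z\<^esub> (Mp2Z_S \<otimes>\<^bsub>Mp2Z\<^esub> Mp2Z_S) = Mp2Z_sign"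
proof -
  obtain \<phi> where \<phi>: "Mp2Z_S \<otimes>\<^bsub>Mp2Z\<^esub> Mp2Z_S = (mat2 (-1) 0 0 (-1), \<phi>)"
    by (simp add: Mp2Z_S_def Mp2Z_mult mat2_mult)
  then have "(mat2 (-1) 0 0 (-1), \<phi>) \<in> carrier Mp2Z"
    using Mp2Z_mult_closed[OF Mp2Z_S_carrier Mp2Z_S_carrier] by simp
  then have "\<phi> \<tau> * \<phi> \<tau> = -1" if "\<tau> \<in> upper_half_plane" for \<tau>
    using that by (simp add: Mp2Z_carrier power2_eq_square)
  moreover have "moebius_map (mat2 (-1) 0 0 (-1)) \<tau> = \<tau>" for \<tau>
    by (simp add: moebius_map_def)
  ultimately show ?thesis
    by (auto simp: \<phi> Mp2Z_mult mat2_mult Mp2Z_sign_def mat2_one restrict_def)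
qed

lemma Mp2Z_sign_carrier: "Mp2Z_sign \<in> carrier Mp2Z"
  unfolding Mp2Z_S_power_4[symmetric] by (intro Mp2Z_mult_closed Mp2Z_S_carrier)

text \<open>The quotient of two roots is continuous with values 1 and -1 on the connected half
  plane, hence constant.\<close>

lemma Mp2Z_fiber:
  assumes "(M, \<phi>) \<in> carrier Mp2Z" "(M, \<phi>') \<in> carrier Mp2Z"
  shows "\<phi>' = \<phi> \<or> (M, \<phi>') = (M, \<phi>) \<otimes>\<^bsub>Mp2Z\<^esub> Mp2Z_sign"
proof -
  have M: "det M = 1" "\<phi> holomorphic_on upper_half_plane" "\<phi> \<in> extensional upper_half_plane"
      "\<And>\<tau>. \<tau> \<in> upper_half_plane \<Longrightarrow> (\<phi> \<tau>)^2 = of_int (M$2$1) * \<tau> + of_int (M$2$2)"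
    and M': "\<phi>' holomorphic_on upper_half_plane" "\<phi>' \<in> extensional upper_half_plane"
      "\<And>\<tau>. \<tau> \<in> upper_half_plane \<Longrightarrow> (\<phi>' \<tau>)^2 = of_int (M$2$1) * \<tau> + of_int (M$2$2)"
    using assms by (auto simp: Mp2Z_carrier)
  have nz: "\<phi> \<tau> \<noteq> 0" if "\<tau> \<in> upper_half_plane" for \<tau>
    using M(4)[OF that] denominator_nonzero[OF M(1) that] by auto
  have pm: "\<phi>' \<tau> / \<phi> \<tau> \<in> {1, -1}" if "\<tau> \<in> upper_half_plane" for \<tau>
  proof -
    have "(\<phi>' \<tau> / \<phi> \<tau>)\<^sup>2 = 1"
      using nz[OF that] M(4)[OF that] M'(3)[OF that] denominator_nonzero[OF M(1) that]
      by (simp add: power_divide)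
    then show ?thesis by (simp add: power2_eq_1_iff)
  qed
  have "(\<lambda>\<tau>. \<phi>' \<tau> / \<phi> \<tau>) constant_on upper_half_plane"
  proof (rule continuous_finite_range_constant)
    show "connected upper_half_plane"
      unfolding upper_half_plane_def by (intro convex_connected convex_halfspace_Im_gt)
    show "continuous_on upper_half_plane (\<lambda>\<tau>. \<phi>' \<tau> / \<phi> \<tau>)"
      using M(2) M'(1) nz by (intro continuous_on_divide holomorphic_on_imp_continuous_on) auto
    show "finite ((\<lambda>\<tau>. \<phi>' \<tau> / \<phi> \<tau>) ` upper_half_plane)"
    proof (rule finite_subset)
      show "(\<lambda>\<tau>. \<phi>' \<tau> / \<phi> \<tau>) ` upper_half_plane \<subseteq> {1, -1}"
        using pm by (rule image_subsetI)
    qed simp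
  qed
  then obtain k where k: "\<And>\<tau>. \<tau> \<in> upper_half_plane \<Longrightarrow> \<phi>' \<tau> / \<phi> \<tau> = k"
    unfolding constant_on_def by auto
  have eq: "\<phi>' \<tau> = k * \<phi> \<tau>" if "\<tau> \<in> upper_half_plane" for \<tau>
    using k[OF that] nz[OF that] by (simp add: field_simps)
  have "\<i> \<in> upper_half_plane" by (simp add: upper_half_plane_def)
  then have "k = 1 \<or> k = -1" using pm[of \<i>] k[of \<i>] by simp
  then show ?thesis
  proof
    assume "k = 1"
    then have "\<phi>' = \<phi>" using eq M(3) M'(2) by (intro extensionalityI) auto
    then show ?thesis ..
  next
    assume "k = -1"
    then have "\<phi>' = (\<lambda>\<tau>\<in>upper_half_plane. - \<phi> \<tau>)"
      using eq M'(2) by (intro extensionalityI[of _ upper_half_plane]) auto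
    moreover have "moebius_map (mat 1) \<tau> = \<tau>" for \<tau>
      by (simp add: moebius_map_def mat_def)
    ultimately have "(M, \<phi>') = (M, \<phi>) \<otimes>\<^bsub>Mp2Z\<^esub> Mp2Z_sign"
      by (simp add: Mp2Z_sign_def Mp2Z_mult fun_eq_iff)
    then show ?thesis ..
  qed
qed

lemma linear_eq_on_axis:
  assumes f: "Vector_Spaces.linear (*s) (*s) f" and g: "Vector_Spaces.linear (*s) (*s) g"
    and eq: "\<And>i. f (axis i 1) = g (axis i (1 :: 'a::field))"
  shows "f v = g v"
proof -
  interpret f: Vector_Spaces.linear "(*s)" "(*s)" f by (rule f)
  interpret g: Vector_Spaces.linear "(*s)" "(*s)" g by (rule g)
  have "f (\<Sum>i\<in>UNIV. (v $ i) *s axis i 1) = g (\<Sum>i\<in>UNIV. (v $ i) *s axis i 1)"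
    by (simp add: f.sum f.scale g.sum g.scale eq)
  then show ?thesis unfolding basis_expansion .
qed

section \<open>Descent to the special linear group and determination of the invariants\<close>

locale weil = lagrangian Q H for Q :: "'d::{finite,ab_group_add} \<Rightarrow> rat_mod_int" and H +
  fixes \<rho> :: "mp2_elem \<Rightarrow> (complex, 'd) vec \<Rightarrow> (complex, 'd) vec"
  assumes weil: "weil_representation Q \<rho>"
begin

lemma rho_mult:
  assumes "g \<in> carrier Mp2Z" "h \<in> carrier Mp2Z"
  shows "\<rho> (g \<otimes>\<^bsub>Mp2Z\<^esub> h) = \<rho> g \<circ> \<rho> h"
  using weil assms by (auto simp: weil_representation_def hom_def GL_def)

lemma rho_GL: "g \<in> carrier Mp2Z \<Longrightarrow> \<rho> g \<in> carrier GL"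
  using weil by (auto simp: weil_representation_def hom_def)

lemma rho_linear: "g \<in> carrier Mp2Z \<Longrightarrow> Vector_Spaces.linear (*s) (*s) (\<rho> g)"
  and rho_bij: "g \<in> carrier Mp2Z \<Longrightarrow> bij (\<rho> g)"
  using rho_GL by (auto simp: GL_def)

lemma rho_T: "\<rho> Mp2Z_T = weil_T Q"
proof
  fix v
  show "\<rho> Mp2Z_T v = weil_T Q v"
  proof (rule linear_eq_on_axis[OF rho_linear[OF Mp2Z_T_carrier] linear_weil_T])
    show "\<rho> Mp2Z_T (axis \<gamma> 1) = weil_T Q (axis \<gamma> 1)" for \<gamma>
      using weil by (auto simp: weil_representation_def weil_T_def vec_eq_iff axis_def)
  qed
qed

lemma rho_S: "\<rho> Mp2Z_S = weil_S Q"
proof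
  fix v
  show "\<rho> Mp2Z_S v = weil_S Q v"
  proof (rule linear_eq_on_axis[OF rho_linear[OF Mp2Z_S_carrier] linear_weil_S])
    fix \<gamma>
    have "\<rho> Mp2Z_S (axis \<gamma> 1) = (1 / complex_of_real (sqrt (real CARD('d)))) *s
        (\<Sum>\<beta>\<in>UNIV. e_mod (- bilin Q \<beta> \<gamma>) *s axis \<beta> 1)"
      using weil unfolding weil_representation_def signature_0 by (simp add: e2pi_def)
    also have "\<dots> = weil_S Q (axis \<gamma> 1)"
      by (simp add: vec_eq_iff weil_S_def axis_def if_distrib cong: if_cong)
    finally show "\<rho> Mp2Z_S (axis \<gamma> 1) = weil_S Q (axis \<gamma> 1)" .
  qed
qed

lemma rho_sign: "\<rho> Mp2Z_sign = id"
  unfolding Mp2Z_S_power_4[symmetric]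
  by (simp add: rho_mult Mp2Z_mult_closed Mp2Z_S_carrier rho_S fun_eq_iff weil_S_order_4)

lemma rho_fst:
  assumes "g \<in> carrier Mp2Z" "g' \<in> carrier Mp2Z" "fst g = fst g'"
  shows "\<rho> g = \<rho> g'"
proof -
  obtain M \<phi> \<phi>' where g: "g = (M, \<phi>)" "g' = (M, \<phi>')"
    using assms(3) by (cases g, cases g') auto
  show ?thesis
    using Mp2Z_fiber[of M \<phi> \<phi>'] assms(1,2) rho_mult[OF assms(1) Mp2Z_sign_carrier]
    unfolding g rho_sign by auto
qed

text \<open>By \<open>rho_fst\<close> the value does not depend on the chosen lift, which makes
  \<open>sigma\<close> multiplicative although the lift is only a choice of preimages.\<close>

definition sigma :: "int^2^2 \<Rightarrow> (complex, 'd) vec \<Rightarrow> (complex, 'd) vec" where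
  "sigma M = \<rho> (Mp2Z_lift M)"

lemma rho_eq_sigma: "g \<in> carrier Mp2Z \<Longrightarrow> \<rho> g = sigma (fst g)"
  unfolding sigma_def
  by (rule rho_fst) (cases g; auto simp: Mp2Z_carrier intro: Mp2Z_lift_carrier)+

lemma sigma_mult:
  assumes "det M = 1" "det M' = 1"
  shows "sigma (M ** M') = sigma M \<circ> sigma M'"
proof -
  have *: "Mp2Z_lift M \<in> carrier Mp2Z" "Mp2Z_lift M' \<in> carrier Mp2Z"
    using assms by (auto intro: Mp2Z_lift_carrier)
  have "\<rho> (Mp2Z_lift M \<otimes>\<^bsub>Mp2Z\<^esub> Mp2Z_lift M') = sigma (fst (Mp2Z_lift M \<otimes>\<^bsub>Mp2Z\<^esub> Mp2Z_lift M'))"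
    by (intro rho_eq_sigma Mp2Z_mult_closed *)
  also have "fst (Mp2Z_lift M \<otimes>\<^bsub>Mp2Z\<^esub> Mp2Z_lift M') = M ** M'"
    by (simp add: Mp2Z_lift_def Mp2Z_mult)
  finally have "sigma (M ** M') = \<rho> (Mp2Z_lift M \<otimes>\<^bsub>Mp2Z\<^esub> Mp2Z_lift M')" ..
  then show ?thesis by (simp only: rho_mult[OF *] sigma_def[of M] sigma_def[of M'])
qed

lemma sigma_hom: "sigma \<in> hom SL2Z GL"
proof (rule homI)
  show "sigma M \<in> carrier GL" if "M \<in> carrier SL2Z" for M
    unfolding sigma_def using that by (intro rho_GL Mp2Z_lift_carrier) simp
qed (simp add: sigma_mult GL_def)

lemma invariantI:
  assumes T: "weil_T Q v = v" and S: "weil_S Q v = v"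
  shows "v \<in> invariants \<rho>"
proof -
  have sT: "sigma (mat2 1 1 0 1) = weil_T Q" and sS: "sigma (mat2 0 (-1) 1 0) = weil_S Q"
    using rho_eq_sigma[OF Mp2Z_T_carrier] rho_eq_sigma[OF Mp2Z_S_carrier]
    by (simp_all add: rho_T rho_S) (simp_all add: Mp2Z_T_def Mp2Z_S_def)
  \<comment> \<open>The guard confines the claim to determinant 1, where \<open>sigma\<close> is
    multiplicative. With modulus 0 the congruence of the induction principle is equality.\<close>
  define P where "P p q r t \<longleftrightarrow> (p * t - q * r = 1 \<longrightarrow> sigma (mat2 p q r t) v = v)" for p q r t
  have P_T: "P p (q + p) r (t + r) \<longleftrightarrow> P p q r t" for p q r t
  proof -
    have "sigma (mat2 p q r t ** mat2 1 1 0 1) v = sigma (mat2 p q r t) v" if "p * t - q * r = 1"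
      using sigma_mult[of "mat2 p q r t" "mat2 1 1 0 1"] that by (simp add: det_2 sT T)
    then show ?thesis by (auto simp: P_def mat2_mult algebra_simps)
  qed
  have P_S: "P q (- p) t (- r)" if "P p q r t" for p q r t
  proof -
    have "sigma (mat2 p q r t ** mat2 0 (-1) 1 0) v = sigma (mat2 p q r t) v" if "p * t - q * r = 1"
      using sigma_mult[of "mat2 p q r t" "mat2 0 (-1) 1 0"] that by (simp add: det_2 sS S)
    then show ?thesis using that by (auto simp: P_def mat2_mult algebra_simps)
  qed
  \<comment> \<open>An idempotent bijection is the identity.\<close>
  have "sigma (mat 1) \<circ> sigma (mat 1) = sigma (mat 1)"
    using sigma_mult[of "mat 1" "mat 1"] by simp
  moreover have "bij (sigma (mat 1))"
    unfolding sigma_def by (intro rho_bij Mp2Z_lift_carrier) simp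
  ultimately have "sigma (mat 1) v = v"
    by (metis bij_is_inj comp_apply injD)
  then have P_one: "P 1 0 0 1" by (simp add: P_def mat2_one)
  have P: "P p q r t" if "p * t - q * r = 1" for p q r t
    by (rule SL2_column_induct[where P = P and N = 0, OF P_one P_T P_S]) (use that in auto)
  have "sigma M v = v" if "det M = 1" for M
  proof -
    obtain p q r t where M: "M = mat2 p q r t" by (rule mat2_cases)
    show ?thesis using P[of p t q r] that by (simp add: M P_def det_2)
  qed
  then show ?thesis
    by (auto simp: invariants_def rho_eq_sigma Mp2Z_carrier)
qed

lemma invariants_eq_span: "invariants \<rho> = vec.span (char_vec ` self_dual_isotropic_subgroups Q)"
proof
  show "invariants \<rho> \<subseteq> vec.span (char_vec ` self_dual_isotropic_subgroups Q)"
  proof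
    fix v assume "v \<in> invariants \<rho>"
    then have "\<rho> Mp2Z_T v = v" "\<rho> Mp2Z_S v = v"
      using Mp2Z_T_carrier Mp2Z_S_carrier by (auto simp: invariants_def)
    then show "v \<in> vec.span (char_vec ` self_dual_isotropic_subgroups Q)"
      by (intro invariant_in_span) (simp_all add: rho_T rho_S)
  qed
  have "char_vec K \<in> invariants \<rho>" if "K \<in> self_dual_isotropic_subgroups Q" for K
  proof -
    \<comment> \<open>Each \<open>K\<close> takes the role of \<open>H\<close>, so that
      \<open>char_vec K\<close> becomes the vector \<open>psi 0 0 0\<close> fixed by S and
      T.\<close>
    interpret K: lagrangian Q K by unfold_locales (rule that)
    show ?thesis by (intro invariantI K.weil_T_char_vec K.weil_S_char_vec)
  qed
  moreover have "vec.subspace (invariants \<rho>)"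
  proof -
    have "\<rho> g 0 = 0" "\<rho> g (x + y) = \<rho> g x + \<rho> g y" "\<rho> g (c *s x) = c *s \<rho> g x"
      if "g \<in> carrier Mp2Z" for g x y c
    proof -
      interpret g: Vector_Spaces.linear "(*s)" "(*s)" "\<rho> g" by (rule rho_linear[OF that])
      show "\<rho> g 0 = 0" "\<rho> g (x + y) = \<rho> g x + \<rho> g y" "\<rho> g (c *s x) = c *s \<rho> g x"
        by (simp_all add: g.zero g.add g.scale)
    qed
    then show ?thesis by (auto simp: vec.subspace_def invariants_def)
  qed
  ultimately show "vec.span (char_vec ` self_dual_isotropic_subgroups Q) \<subseteq> invariants \<rho>"
    by (intro vec.span_minimal) auto
qed

end

theorem theorem3p1:
  fixes Q :: "'d::{finite,ab_group_add} \<Rightarrow> rat_mod_int"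
    and \<rho> :: "mp2_elem \<Rightarrow> (complex, 'd) vec \<Rightarrow> (complex, 'd) vec"
  assumes "discriminant_form Q"
    and "self_dual_isotropic_subgroups Q \<noteq> {}"
    and "weil_representation Q \<rho>"
  shows "(\<exists>\<sigma>\<in>hom SL2Z GL. \<forall>g\<in>carrier Mp2Z. \<rho> g = \<sigma> (fst g)) \<and>
    invariants \<rho> = vec.span (char_vec ` self_dual_isotropic_subgroups Q)"
proof -
  obtain H where "H \<in> self_dual_isotropic_subgroups Q" using assms(2) by auto
  then interpret weil Q H \<rho> by unfold_locales (use assms in auto)
  show ?thesis using sigma_hom rho_eq_sigma invariants_eq_span by blast
qed

end
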